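(* The Moyal product $*_{\mathrm h}$ on $(\mathrm{Sym}\,L)[\mathrm h]$ is associative: for all $P,R,S\in(\mathrm{Sym}\,L)[\mathrm h]$, $(P*_{\mathrm h}R)*_{\mathrm h}S=P*_{\mathrm h}(R*_{\mathrm h}S)$.
   Context: Let $\mathbf k$ be a field of characteristic $0$ and $Q$ a quiver with vertex set $I$. The double $\overline Q$ has edges $e,e^*$ for $e\in Q$, where $e^*$ is the reverse of $e$ and $(e^* )^*=e$; $*$ denotes the edge-reversal involution. $L$ is the $\mathbf k$-vector space with basis the cyclic paths (necklaces) in $\overline Q$, up to cyclic rotation, including the trivial path at each vertex. $\mathrm{Sym}\,L$ is its symmetric algebra over $\mathbf k$, with product written $\&$; its basis consists of collections $P=P_1\&\cdots\&P_k\&v_1\&\cdots\&v_q$ with $P_i=a_{i1}\cdots a_{il_i}$ necklaces of positive length and $v_s\in I$. The set of abstract edges of $P$ is $X=\{(i,j):1\le i\le k,1\le j\le l_i\}$, with $\mathrm{pr}_X(i,j)=a_{ij}\in\overline Q$ and $(i,j)+1=(i,j+1)$, $j$ taken modulo $l_i$. **Product.** For collections $P,R$ with sets of abstract edges $X,Y$, $$P*_{\mathrm h}R=\sum_{(I_X,I_Y,\phi)}\frac{\mathrm h^{\#I_X}}{2^{\#I_X}}\,(-1)^{\#(I_Y\cap\mathrm{pr}_Y^{-1}(Q))}\,PR_{I_X,I_Y,\phi},$$ over all subsets $I_X\subset X$, $I_Y\subset Y$ and bijections $\phi:I_X\to I_Y$ with $\mathrm{pr}_Y\circ\phi=*\circ\mathrm{pr}_X$;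 extend $\mathbf k[\mathrm h]$-bilinearly. **Cutting and gluing.** $PR_{I_X,I_Y,\phi}$ is the following collection. Extend $\phi$ to an involution of $I_X\sqcup I_Y$. Define $f:X\sqcup Y\to X\sqcup Y$ by $f(x)=x+1$ if $x\notin I_X\sqcup I_Y$ and $f(x)=\phi(x)+1$ if $x\in I_X\sqcup I_Y$. Each orbit of the permutation $f$ gives one member of the new collection: the necklace obtained by reading in order the edges of the orbit not in $I_X\sqcup I_Y$, or, if all edges of the orbit lie in $I_X\sqcup I_Y$, the trivial path at the start vertex of any of them. The trivial paths of $P$ and $R$ are kept. *)

theory Defs
  imports
    "Graph_Theory.Arc_Walk"
    "HOL-Combinatorics.Orbits"
    "HOL-Computational_Algebra.Polynomial"
    "HOL-Library.Multiset"
    "HOL-Library.Poly_Mapping"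
begin

section \<open>The double of a quiver\<close>

text \<open>
  A quiver is a \<^locale>\<open>wf_digraph\<close>: loops and multiple arrows are allowed, and neither
  vertices nor arrows need be finite in number.
\<close>

datatype 'e dedge = Orig 'e | Star 'e

primrec rev_edge :: "'e dedge \<Rightarrow> 'e dedge" where
  "rev_edge (Orig e) = Star e"
| "rev_edge (Star e) = Orig e"

definition double :: "('v, 'e) pre_digraph \<Rightarrow> ('v, 'e dedge) pre_digraph" where
  "double Q = \<lparr> verts = verts Q, arcs = Orig ` arcs Q \<union> Star ` arcs Q,
                tail = case_dedge (tail Q) (head Q), head = case_dedge (head Q) (tail Q) \<rparr>"

lemma wf_double: "wf_digraph Q \<Longrightarrow> wf_digraph (double Q)"
  by (auto simp: double_def wf_digraph_def)

section \<open>Necklaces and the symmetric algebra\<close>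

quotient_type 'a cyclic_word = "'a list" / "\<lambda>u w. \<exists>n. w = rotate n u"
proof (rule equivpI)
  show "reflp (\<lambda>u w :: 'a list. \<exists>n. w = rotate n u)"
    by (rule reflpI) (metis rotate0 id_apply)
  show "symp (\<lambda>u w :: 'a list. \<exists>n. w = rotate n u)"
  proof (rule sympI)
    fix u w :: "'a list" assume "\<exists>n. w = rotate n u"
    then obtain n where w: "w = rotate n u" by blast
    show "\<exists>n. u = rotate n w"
    proof (cases "u = []")
      case True
      then show ?thesis using w by simp
    next
      case False
      define m where "m = length u * n - n"
      have "n \<le> length u * n" using False by (cases u) auto
      then have "m + n = length u * n" by (simp add: m_def)
      then have "rotate m w = u"
        by (simp add: w rotate_rotate rotate_id)
      then show ?thesis by metis
    qed
  qed
  show "transp (\<lambda>u w :: 'a list. \<exists>n. w = rotate n u)"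
    by (rule transpI) (metis rotate_rotate)
qed

datatype ('v, 'e) necklace = Triv 'v | Cyc "'e dedge cyclic_word"

definition necklaces :: "('v, 'e) pre_digraph \<Rightarrow> ('v, 'e) necklace set" where
  "necklaces Q = Triv ` verts Q \<union>
     {Cyc (abs_cyclic_word w) | w. w \<noteq> [] \<and> (\<exists>v. pre_digraph.awalk (double Q) v w v)}"

type_synonym ('v, 'e) collection = "('v, 'e) necklace multiset"

text \<open>
  \<open>Sym L\<close> is the polynomial algebra on the necklaces.  Its monomials are the finite multisets
  of necklaces, so it consists of the finitely supported functions on such multisets, and the
  multiplication that \<^theory>\<open>HOL-Library.Poly_Mapping\<close> puts on them is the product \<open>&\<close>.
  The type covers all cyclic words in the letters \<open>e\<close>, \<open>e\<^sup>*\<close>; the actual \<open>Sym L\<close> of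
  the quiver \<open>Q\<close> is the subset \<open>SymL Q\<close>.
\<close>

definition SymL :: "('v, 'e) pre_digraph \<Rightarrow> (('v, 'e) collection \<Rightarrow>\<^sub>0 'k::field_char_0) set" where
  "SymL Q = {p. \<forall>P \<in> Poly_Mapping.keys p. set_mset P \<subseteq> necklaces Q}"

definition SymL_h :: "('v, 'e) pre_digraph \<Rightarrow> (('v, 'e) collection \<Rightarrow>\<^sub>0 'k::field_char_0) poly set" where
  "SymL_h Q = {p. \<forall>n. coeff p n \<in> SymL Q}"

section \<open>Abstract edges\<close>

text \<open>
  Writing a collection as \<open>P\<^sub>1 & \<dots> & P\<^sub>k & v\<^sub>1 & \<dots> & v\<^sub>q\<close> with \<open>P\<^sub>i = a\<^sub>i\<^sub>1 \<dots> a\<^sub>i\<^sub>l\<close>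
  involves choosing an order of the necklaces of positive length and a first edge of each.  The
  product does not depend on this choice.  Indices start from \<open>0\<close>.
\<close>

definition words :: "('v, 'e) collection \<Rightarrow> 'e dedge list list" where
  "words P = (SOME ws. image_mset (\<lambda>w. Cyc (abs_cyclic_word w)) (mset ws) =
                       filter_mset (\<lambda>N. \<nexists>v. N = Triv v) P)"

lemma mset_words:
  "image_mset (\<lambda>w. Cyc (abs_cyclic_word w)) (mset (words P)) = filter_mset (\<lambda>N. \<nexists>v. N = Triv v) P"
proof -
  obtain Ns where Ns: "mset Ns = filter_mset (\<lambda>N. \<nexists>v. N = Triv v) P"
    using ex_mset by blast
  define g :: "('a, 'b) necklace \<Rightarrow> 'b dedge list"
    where "g = (\<lambda>N. case N of Cyc c \<Rightarrow> rep_cyclic_word c | Triv v \<Rightarrow> [])"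
  have "Cyc (abs_cyclic_word (g N)) = N" if "\<nexists>v. N = Triv v" for N
    using that by (cases N) (auto simp: g_def Quotient_abs_rep[OF Quotient_cyclic_word])
  then have "image_mset (\<lambda>w. Cyc (abs_cyclic_word w)) (mset (map g Ns)) = mset Ns"
    by (auto simp: Ns image_mset.compositionality o_def intro!: multiset.map_ident_strong)
  then show ?thesis
    unfolding words_def using Ns by (metis (mono_tags, lifting) someI_ex)
qed

definition trivials :: "('v, 'e) collection \<Rightarrow> ('v, 'e) collection" where
  "trivials P = filter_mset (\<lambda>N. \<exists>v. N = Triv v) P"

definition abs_edges :: "'a list list \<Rightarrow> (nat \<times> nat) set" where
  "abs_edges ws = {(i, j). i < length ws \<and> j < length (ws ! i)}"

definition pr :: "'a list list \<Rightarrow> nat \<times> nat \<Rightarrow> 'a" where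
  "pr ws = (\<lambda>(i, j). ws ! i ! j)"

definition next_edge :: "'a list list \<Rightarrow> nat \<times> nat \<Rightarrow> nat \<times> nat" where
  "next_edge ws = (\<lambda>(i, j). (i, Suc j mod length (ws ! i)))"

section \<open>Cutting and gluing\<close>

text \<open>
  The disjoint union of \<open>X\<close> and \<open>Y\<close> is \<open>X <+> Y\<close>.  Paths are read from left to right, as is
  needed for the edges of a completely cut orbit to have a common start vertex.  The edge from
  which an orbit is read is irrelevant up to rotation.
\<close>

definition glue_inv :: "('x \<Rightarrow> 'y) \<Rightarrow> 'x set \<Rightarrow> 'x + 'y \<Rightarrow> 'x + 'y" where
  "glue_inv \<phi> IX = case_sum (\<lambda>x. Inr (\<phi> x)) (\<lambda>y. Inl (inv_into IX \<phi> y))"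

definition glue_perm :: "'a list list \<Rightarrow> 'a list list \<Rightarrow> (nat \<times> nat) set \<Rightarrow> (nat \<times> nat) set \<Rightarrow>
    (nat \<times> nat \<Rightarrow> nat \<times> nat) \<Rightarrow> (nat \<times> nat) + (nat \<times> nat) \<Rightarrow> (nat \<times> nat) + (nat \<times> nat)" where
  "glue_perm ws us IX IY \<phi> z =
     map_sum (next_edge ws) (next_edge us) (if z \<in> IX <+> IY then glue_inv \<phi> IX z else z)"

definition read_orbit :: "('v, 'e) pre_digraph \<Rightarrow> ('z \<Rightarrow> 'z) \<Rightarrow> ('z \<Rightarrow> 'e dedge) \<Rightarrow> 'z set \<Rightarrow>
    'z set \<Rightarrow> ('v, 'e) necklace" where
  "read_orbit Q f lab D Z =
     (let z = (SOME z. z \<in> Z);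
          zs = filter (\<lambda>y. y \<notin> D) (map (\<lambda>n. (f ^^ n) z) [0..<card Z])
      in if zs = [] then Triv (tail (double Q) (lab z))
         else Cyc (abs_cyclic_word (map lab zs)))"

definition cut_glue :: "('v, 'e) pre_digraph \<Rightarrow> ('v, 'e) collection \<Rightarrow> ('v, 'e) collection \<Rightarrow>
    (nat \<times> nat) set \<Rightarrow> (nat \<times> nat) set \<Rightarrow> (nat \<times> nat \<Rightarrow> nat \<times> nat) \<Rightarrow> ('v, 'e) collection" where
  "cut_glue Q P R IX IY \<phi> =
     (let ws = words P; us = words R; f = glue_perm ws us IX IY \<phi>;
          orbits = orbit f ` (abs_edges ws <+> abs_edges us)
      in image_mset (read_orbit Q f (case_sum (pr ws) (pr us)) (IX <+> IY)) (mset_set orbits)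
           + trivials P + trivials R)"

section \<open>The Moyal product\<close>

text \<open>The maps \<open>\<phi>\<close> are made extensional so that each bijection is counted once.\<close>

definition gluings :: "('v, 'e) collection \<Rightarrow> ('v, 'e) collection \<Rightarrow>
    ((nat \<times> nat) set \<times> (nat \<times> nat) set \<times> (nat \<times> nat \<Rightarrow> nat \<times> nat)) set" where
  "gluings P R = {(IX, IY, \<phi>). IX \<subseteq> abs_edges (words P) \<and> IY \<subseteq> abs_edges (words R) \<and>
     \<phi> \<in> extensional IX \<and> bij_betw \<phi> IX IY \<and>
     (\<forall>x \<in> IX. pr (words R) (\<phi> x) = rev_edge (pr (words P) x))}"

definition moyal_basis :: "('v, 'e) pre_digraph \<Rightarrow> ('v, 'e) collection \<Rightarrow> ('v, 'e) collection \<Rightarrow>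
    (('v, 'e) collection \<Rightarrow>\<^sub>0 'k::field_char_0) poly" where
  "moyal_basis Q P R = (\<Sum>(IX, IY, \<phi>) \<in> gluings P R.
     monom (Poly_Mapping.single (cut_glue Q P R IX IY \<phi>)
              ((-1) ^ card {y \<in> IY. pr (words R) y \<in> Orig ` arcs Q} / 2 ^ card IX)) (card IX))"

text \<open>The scalar \<open>c\<close> is the element \<open>Poly_Mapping.single 0 c\<close> of \<open>Sym L\<close>.\<close>

definition moyal :: "('v, 'e) pre_digraph \<Rightarrow> (('v, 'e) collection \<Rightarrow>\<^sub>0 'k::field_char_0) poly \<Rightarrow>
    (('v, 'e) collection \<Rightarrow>\<^sub>0 'k) poly \<Rightarrow> (('v, 'e) collection \<Rightarrow>\<^sub>0 'k) poly" where
  "moyal Q p r = (\<Sum>m\<le>degree p. \<Sum>n\<le>degree r.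
     \<Sum>P \<in> Poly_Mapping.keys (coeff p m). \<Sum>R \<in> Poly_Mapping.keys (coeff r n).
       monom (Poly_Mapping.single 0
         (Poly_Mapping.lookup (coeff p m) P * Poly_Mapping.lookup (coeff r n) R)) (m + n)
       * moyal_basis Q P R)"

end

theory Submission
  imports Defs
begin

text \<open>
  Put the abstract edges of three collections into one set \<open>V = X \<union> Y \<union> Z\<close> with a permutation
  \<open>n\<close> and a labelling.  A gluing is then a matching \<open>M\<close> of oppositely labelled edges, and the glued
  collection is read off the permutation \<open>n \<circ> mate M\<close>.  Its abstract edges are the unmatched
  ones, with the first return map of \<open>n \<circ> mate M\<close> as successor.  Since first return maps compose,
  gluing along \<open>M\<^sub>1\<close> and then along \<open>M\<^sub>2\<close> agrees with gluing along \<open>M\<^sub>1 \<union> M\<^sub>2\<close>.  Hence both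
  bracketings are the sum over all matchings contained in
  \<open>X \<times> Y \<union> X \<times> Z \<union> Y \<times> Z\<close>, with a weight that is a product over the matched pairs.
\<close>

section \<open>Cycles of a permutation and first return maps\<close>

text \<open>Two losses stand in the way of iterating the gluing. \<open>words\<close> picks the
  order and the first letters of the words of a glued collection by Hilbert choice, so its abstract
  edges are the surviving edges only up to an isomorphism of labelled permutations; the product is
  therefore computed in an arbitrary isomorphic model (\<open>cyc_iso\<close>), which lets both
  bracketings share one carrier. A first return map forgets the cycles that were cut completely;
  they have become trivial paths and are carried along separately (\<open>dead\<close>). The vertex
  of such a path is taken from an arbitrary edge of the cycle. It is well defined because gluing at
  an edge preserves its start vertex, which rests on the words being closed walks
  (\<open>walks\<close>); here membership in \<open>SymL_h Q\<close> enters, and the condition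
  passes to return maps. The sign is not symmetric in the two edges of a pair, so pairs stay
  ordered, from the earlier factor to the later one; this order is the same in both
  bracketings.\<close>

definition is_cycle :: "('a \<Rightarrow> 'a) \<Rightarrow> 'a list \<Rightarrow> bool" where
  "is_cycle f zs \<longleftrightarrow> zs \<noteq> [] \<and> distinct zs \<and> map f zs = rotate1 zs"

lemma is_cycle_rotate: "is_cycle f zs \<Longrightarrow> is_cycle f (rotate k zs)"
  by (simp add: is_cycle_def rotate_map[symmetric] rotate1_rotate_swap)

lemma is_cycle_cong: "(\<And>z. z \<in> set zs \<Longrightarrow> f z = g z) \<Longrightarrow> is_cycle f zs \<longleftrightarrow> is_cycle g zs"
  unfolding is_cycle_def by (metis map_cong)

lemma is_cycle_funpow_nth:
  assumes "is_cycle f zs" "i < length zs"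
  shows "(f ^^ k) (zs ! i) = zs ! ((i + k) mod length zs)"
proof (induction k)
  case 0 then show ?case using assms by simp
next
  case (Suc k)
  let ?j = "(i + k) mod length zs"
  have j: "?j < length zs" using assms by (intro mod_less_divisor) auto
  have "f (zs ! ?j) = map f zs ! ?j" using j by simp
  also have "\<dots> = rotate1 zs ! ?j" using assms by (simp add: is_cycle_def)
  also have "\<dots> = zs ! ((i + Suc k) mod length zs)" using j by (simp add: nth_rotate1 mod_Suc_eq)
  finally show ?case using Suc by simp
qed

lemma is_cycle_funpow_hd:
  assumes "is_cycle f zs"
  shows "map (\<lambda>n. (f ^^ n) (hd zs)) [0..<length zs] = zs"
proof (rule nth_equalityI)
  fix i assume "i < length (map (\<lambda>n. (f ^^ n) (hd zs)) [0..<length zs])"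
  then have i: "i < length zs" by simp
  have "hd zs = zs ! 0" using assms by (simp add: is_cycle_def hd_conv_nth)
  moreover have "(f ^^ i) (zs ! 0) = zs ! i"
    using is_cycle_funpow_nth[OF assms, of 0 i] i by (metis add_0 gr_zeroI mod_less not_less_zero)
  ultimately show "map (\<lambda>n. (f ^^ n) (hd zs)) [0..<length zs] ! i = zs ! i"
    using i by simp
qed simp

lemma rotate_to_hd:
  assumes "z \<in> set zs"
  obtains k zs' where "rotate k zs = z # zs'"
proof -
  obtain us vs where "zs = us @ z # vs" using assms by (metis split_list)
  then have "rotate (length us) zs = z # vs @ us" by (simp add: rotate_append)
  then show ?thesis using that by blast
qed

text \<open>\<open>read_orbit\<close> starts from a point picked by \<open>SOME\<close>; whatever
  the point, what it traverses is a rotation of any given list of the cycle, and a cyclic word does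
  not see the rotation.\<close>

lemma is_cycle_funpow:
  assumes "is_cycle f zs" "z \<in> set zs"
  obtains k where "map (\<lambda>n. (f ^^ n) z) [0..<card (set zs)] = rotate k zs"
proof -
  obtain k zs' where k: "rotate k zs = z # zs'" using assms(2) by (rule rotate_to_hd)
  have "card (set zs) = length (rotate k zs)"
    using assms(1) by (simp add: is_cycle_def distinct_card)
  then show ?thesis
    using is_cycle_funpow_hd[OF is_cycle_rotate[OF assms(1), of k]] k that[of k] by simp
qed

lemma is_cycle_mem:
  assumes "is_cycle f zs" "z \<in> set zs"
  shows "f z \<in> set zs"
  using assms unfolding is_cycle_def by (metis image_eqI list.set_map set_rotate1)

lemma orbit_is_cycle:
  assumes "is_cycle f zs" "z \<in> set zs"
  shows "orbit f z = set zs"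
proof
  show "orbit f z \<subseteq> set zs"
  proof
    fix y assume "y \<in> orbit f z"
    then show "y \<in> set zs"
      by (induction rule: orbit.induct) (auto intro: is_cycle_mem[OF assms(1)] assms(2))
  qed
  show "set zs \<subseteq> orbit f z"
  proof
    fix y assume "y \<in> set zs"
    then obtain j where j: "j < length zs" "y = zs ! j" by (auto simp: in_set_conv_nth)
    obtain i where i: "i < length zs" "z = zs ! i" using assms(2) by (auto simp: in_set_conv_nth)
    \<comment> \<open>Adding \<open>length zs\<close> keeps the exponent positive, as
      \<open>orbit\<close> consists of positive iterates only, and makes the truncated subtraction
      exact.\<close>
    have "(f ^^ (length zs + j - i)) z = zs ! ((i + (length zs + j - i)) mod length zs)"
      unfolding i(2) by (rule is_cycle_funpow_nth[OF assms(1) i(1)])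
    also have "\<dots> = y" using i j by simp
    finally show "y \<in> orbit f z" using i by (auto simp: orbit_altdef intro!: exI[of _ "length zs + j - i"])
  qed
qed

lemma funpow_mem: "f ` V \<subseteq> V \<Longrightarrow> x \<in> V \<Longrightarrow> (f ^^ k) x \<in> V"
  by (induction k) auto

text \<open>Finiteness forces a repetition among the iterates of x, injectivity on V cancels it to a
  return to x itself, and minimality of the period makes the listed iterates distinct.\<close>

lemma is_cycle_exists:
  assumes "finite V" "bij_betw f V V" "x \<in> V"
  obtains zs where "is_cycle f zs" "set zs \<subseteq> V" "hd zs = x"
proof -
  have V: "f ` V \<subseteq> V" and inj: "inj_on f V" using assms(2) by (auto simp: bij_betw_def)
  have cancel: "(f ^^ (j - i)) x = x" if "(f ^^ i) x = (f ^^ j) x" "i \<le> j" for i j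
    using that
  proof (induction i arbitrary: j)
    case (Suc i)
    then obtain j' where j': "j = Suc j'" "i \<le> j'" by (cases j) auto
    then have "(f ^^ i) x = (f ^^ j') x"
      using Suc.prems(1) inj_onD[OF inj] funpow_mem[OF V assms(3)] by simp
    then show ?case using Suc.IH j' by simp
  qed simp
  have "\<not> inj (\<lambda>k. (f ^^ k) x)"
    using assms(1) funpow_mem[OF V assms(3)]
    by (metis finite_imageD finite_subset image_subsetI infinite_UNIV_nat)
  then obtain i j where ij: "i < j" "(f ^^ i) x = (f ^^ j) x"
    unfolding inj_def by (metis nat_neq_iff)
  define p where "p = (LEAST p. 0 < p \<and> (f ^^ p) x = x)"
  have "0 < p \<and> (f ^^ p) x = x"
    unfolding p_def by (rule LeastI[of _ "j - i"]) (use ij cancel[of i j] in auto)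
  then have p: "0 < p" "(f ^^ p) x = x" by auto
  have least: "p \<le> q" if "0 < q" "(f ^^ q) x = x" for q
    unfolding p_def using that by (intro Least_le) auto
  define zs where "zs = map (\<lambda>k. (f ^^ k) x) [0..<p]"
  have "distinct zs"
  proof -
    have "i = j" if "i < p" "j < p" "(f ^^ i) x = (f ^^ j) x" "i \<le> j" for i j
      using cancel[of i j] least[of "j - i"] that by (cases "i = j") auto
    then have "inj_on (\<lambda>k. (f ^^ k) x) {0..<p}"
      unfolding inj_on_def by (metis atLeastLessThan_iff nat_le_linear)
    then show ?thesis by (simp add: zs_def distinct_map)
  qed
  moreover have "map f zs = rotate1 zs"
  proof (rule nth_equalityI)
    fix i assume "i < length (map f zs)"
    then show "map f zs ! i = rotate1 zs ! i"
      using p by (cases "Suc i = p") (auto simp: zs_def nth_rotate1)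
  qed (simp add: zs_def)
  moreover have "zs \<noteq> []" "hd zs = x" using p by (auto simp: zs_def hd_conv_nth)
  moreover have "set zs \<subseteq> V" using funpow_mem[OF V assms(3)] by (auto simp: zs_def)
  ultimately show ?thesis using that by (auto simp: is_cycle_def)
qed

lemma orbit_cycle_exists:
  assumes "finite V" "bij_betw f V V" "A \<in> orbit f ` V"
  obtains zs where "is_cycle f zs" "set zs = A" "A \<subseteq> V"
proof -
  obtain x where x: "x \<in> V" "A = orbit f x" using assms(3) by blast
  obtain zs where zs: "is_cycle f zs" "set zs \<subseteq> V" "hd zs = x"
    using is_cycle_exists[OF assms(1,2) x(1)] .
  then have "set zs = A"
    using orbit_is_cycle[of f zs x] x(2) by (metis hd_in_set is_cycle_def)
  then show ?thesis using that zs by blast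
qed

text \<open>The first return map to the complement of \<open>D\<close>; unspecified if the iterates stay in \<open>D\<close>.\<close>

definition ret :: "('a \<Rightarrow> 'a) \<Rightarrow> 'a set \<Rightarrow> 'a \<Rightarrow> 'a" where
  "ret f D z = (f ^^ Suc (LEAST k. (f ^^ Suc k) z \<notin> D)) z"

lemma ret_simp1: "f z \<notin> D \<Longrightarrow> ret f D z = f z"
proof -
  assume "f z \<notin> D"
  then have "(LEAST k. (f ^^ Suc k) z \<notin> D) = 0" by (intro Least_eq_0) simp
  then show ?thesis by (simp add: ret_def)
qed

lemma ret_simp2:
  assumes "f z \<in> D" "(f ^^ Suc k) (f z) \<notin> D"
  shows "ret f D z = ret f D (f z)"
proof -
  have "(LEAST k. (f ^^ Suc k) z \<notin> D) = Suc (LEAST k. (f ^^ Suc (Suc k)) z \<notin> D)"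
    by (rule Least_Suc[of _ "Suc k"]) (use assms in \<open>simp_all add: funpow_swap1\<close>)
  then show ?thesis by (simp add: ret_def funpow_swap1)
qed

text \<open>The walk is followed step by step, with y as a guaranteed stop. The existence clause
  rides along because \<open>ret_simp2\<close> asks for it in the inductive step.\<close>

lemma ret_path:
  assumes "map f (x # xs) = xs @ [y]" "y \<notin> D"
  shows "ret f D x = hd (filter (\<lambda>z. z \<notin> D) (xs @ [y])) \<and> (\<exists>k. (f ^^ Suc k) x \<notin> D)"
  using assms(1)
proof (induction xs arbitrary: x)
  case Nil
  then show ?case using assms(2) by (auto simp: ret_simp1 intro!: exI[of _ 0])
next
  case (Cons x' xs)
  then have x': "f x = x'" "map f (x' # xs) = xs @ [y]" by auto
  from Cons.IH[OF x'(2)] obtain k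
    where k: "(f ^^ Suc k) x' \<notin> D" and r: "ret f D x' = hd (filter (\<lambda>z. z \<notin> D) (xs @ [y]))" by blast
  have "(f ^^ Suc (Suc k)) x \<notin> D" using k x'(1) by (simp add: funpow_swap1)
  moreover have "ret f D x = hd (filter (\<lambda>z. z \<notin> D) ((x' # xs) @ [y]))"
    using k r x'(1) by (cases "x' \<in> D") (auto simp: ret_simp1 ret_simp2[of f x D k])
  ultimately show ?case by blast
qed

text \<open>Writing the successors as \<open>tl (xs @ [y])\<close> gives hypothesis and conclusion
  the same form, empty list included, so that deleting D turns a path of f into a path of
  \<open>ret f D\<close>.\<close>

lemma map_ret_filter_path:
  assumes "map f xs = tl (xs @ [y])" "y \<notin> D"
  shows "map (ret f D) (filter (\<lambda>z. z \<notin> D) xs) = tl (filter (\<lambda>z. z \<notin> D) (xs @ [y]))"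
  using assms(1)
proof (induction xs)
  case (Cons x xs)
  then have "map f (x # xs) = xs @ [y]" by simp
  then have r: "ret f D x = hd (filter (\<lambda>z. z \<notin> D) (xs @ [y]))" using ret_path assms(2) by metis
  have "map f xs = tl (xs @ [y])" using Cons.prems by (cases xs) auto
  then have IH: "map (ret f D) (filter (\<lambda>z. z \<notin> D) xs) = tl (filter (\<lambda>z. z \<notin> D) (xs @ [y]))"
    by (rule Cons.IH)
  have "filter (\<lambda>z. z \<notin> D) (xs @ [y]) \<noteq> []" using assms(2) by simp
  then show ?case using r IH by (cases "x \<in> D") (auto simp: tl_append split: list.splits)
qed (simp add: assms(2))

lemma rotate_filter:
  obtains m where "filter P (rotate k zs) = rotate m (filter P zs)"
proof -
  let ?i = "k mod length zs"
  have "filter P (rotate k zs) = filter P (drop ?i zs) @ filter P (take ?i zs)"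
    by (simp add: rotate_drop_take)
  also have "\<dots> = rotate (length (filter P (take ?i zs))) (filter P (take ?i zs) @ filter P (drop ?i zs))"
    by (simp add: rotate_append)
  also have "filter P (take ?i zs) @ filter P (drop ?i zs) = filter P zs"
    by (metis append_take_drop_id filter_append)
  finally show ?thesis using that by blast
qed

text \<open>The cycle is opened at a point z outside D and closed up by z again; this is a path
  ending outside D, as \<open>map_ret_filter_path\<close> needs.\<close>

lemma is_cycle_ret:
  assumes "is_cycle f zs" "\<not> set zs \<subseteq> D"
  shows "is_cycle (ret f D) (filter (\<lambda>z. z \<notin> D) zs)"
proof -
  let ?P = "\<lambda>z. z \<notin> D"
  obtain z where z: "z \<in> set zs" "z \<notin> D" using assms(2) by blast
  obtain k zs' where k: "rotate k zs = z # zs'" using z(1) by (rule rotate_to_hd)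
  have c: "is_cycle f (z # zs')" using is_cycle_rotate[OF assms(1), of k] k by simp
  then have "map f (z # zs') = tl ((z # zs') @ [z])" by (simp add: is_cycle_def)
  from map_ret_filter_path[OF this z(2)]
  have "is_cycle (ret f D) (filter ?P (z # zs'))"
    using c z(2) by (auto simp: is_cycle_def)
  moreover obtain m where "filter ?P (rotate k zs) = rotate m (filter ?P zs)" by (rule rotate_filter)
  ultimately have "is_cycle (ret f D) (rotate m (filter ?P zs))" using k by simp
  then have *: "map (ret f D) (rotate m (filter ?P zs)) = rotate1 (rotate m (filter ?P zs))"
    by (simp add: is_cycle_def)
  \<comment> \<open>So far the equation holds for a rotation of the filtered list;
    \<open>rotate m\<close> commutes with \<open>map\<close> and \<open>rotate1\<close> and is
    injective, so it can be cancelled.\<close>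
  then have "rotate m (map (ret f D) (filter ?P zs)) = rotate m (rotate1 (filter ?P zs))"
    by (simp only: rotate_map rotate1_rotate_swap)
  then have "map (ret f D) (filter ?P zs) = rotate1 (filter ?P zs)"
    using inj_fn[OF inj_rotate1, of m] unfolding rotate_def by (auto dest: injD)
  then show ?thesis using assms(1) z by (auto simp: is_cycle_def filter_empty_conv)
qed

lemma ret_mem:
  assumes "finite V" "bij_betw f V V" "w \<in> V - D"
  shows "ret f D w \<in> V - D" "orbit (ret f D) w = orbit f w - D"
    "w \<in> ret f D ` (V - D)"
proof -
  obtain zs where zs: "is_cycle f zs" "set zs \<subseteq> V" "hd zs = w"
    using is_cycle_exists[OF assms(1,2)] assms(3) by blast
  have w: "w \<in> set zs" using zs by (auto simp: is_cycle_def)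
  have c: "is_cycle (ret f D) (filter (\<lambda>z. z \<notin> D) zs)"
    using is_cycle_ret[OF zs(1)] w assms(3) by blast
  have w': "w \<in> set (filter (\<lambda>z. z \<notin> D) zs)" using w assms(3) by auto
  show "ret f D w \<in> V - D" using is_cycle_mem[OF c w'] zs(2) by auto
  show "orbit (ret f D) w = orbit f w - D"
    unfolding orbit_is_cycle[OF c w'] orbit_is_cycle[OF zs(1) w] by auto
  have "set (rotate1 (filter (\<lambda>z. z \<notin> D) zs)) = ret f D ` set (filter (\<lambda>z. z \<notin> D) zs)"
    using c unfolding is_cycle_def by (metis list.set_map)
  then show "w \<in> ret f D ` (V - D)" using w' zs(2) by auto
qed

lemma bij_betw_ret:
  assumes "finite V" "bij_betw f V V"
  shows "bij_betw (ret f D) (V - D) (V - D)"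
proof -
  have "ret f D ` (V - D) = V - D"
  proof
    show "ret f D ` (V - D) \<subseteq> V - D" by (rule image_subsetI) (rule ret_mem(1)[OF assms])
    show "V - D \<subseteq> ret f D ` (V - D)" by (rule subsetI) (rule ret_mem(3)[OF assms])
  qed
  moreover from this have "inj_on (ret f D) (V - D)"
    by (intro finite_surj_inj) (simp_all add: assms(1))
  ultimately show ?thesis unfolding bij_betw_def by simp
qed

text \<open>Orbits that meet coincide, so \<open>A - D\<close> determines A once it is nonempty.
  Orbits inside D leave nothing behind and are excluded; \<open>dead\<close> keeps account of
  them.\<close>

lemma orbits_ret:
  assumes "finite V" "bij_betw f V V"
  shows "bij_betw (\<lambda>A. A - D) {A \<in> orbit f ` V. \<not> A \<subseteq> D} (orbit (ret f D) ` (V - D))"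
proof (rule bij_betw_imageI)
  have same: "A = B" if "A \<in> orbit f ` V" "B \<in> orbit f ` V" "x \<in> A" "x \<in> B" for A B x
    using that by (metis assms orbit_cycle_exists orbit_is_cycle)
  have self: "w \<in> orbit f w" if "w \<in> V" for w
    using that by (metis assms is_cycle_exists orbit_is_cycle hd_in_set is_cycle_def)
  show "inj_on (\<lambda>A. A - D) {A \<in> orbit f ` V. \<not> A \<subseteq> D}"
  proof (rule inj_onI)
    fix A B assume A: "A \<in> {A \<in> orbit f ` V. \<not> A \<subseteq> D}" and B: "B \<in> {A \<in> orbit f ` V. \<not> A \<subseteq> D}"
      and eq: "A - D = B - D"
    then obtain x where "x \<in> A - D" by blast
    then show "A = B" using same A B eq by blast
  qed
  show "(\<lambda>A. A - D) ` {A \<in> orbit f ` V. \<not> A \<subseteq> D} = orbit (ret f D) ` (V - D)"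
  proof (intro equalityI subsetI)
    fix B assume "B \<in> (\<lambda>A. A - D) ` {A \<in> orbit f ` V. \<not> A \<subseteq> D}"
    then obtain A where A: "A \<in> orbit f ` V" "\<not> A \<subseteq> D" "B = A - D" by blast
    then obtain w where w: "w \<in> A" "w \<notin> D" by blast
    have "A \<subseteq> V" using A(1) assms orbit_cycle_exists by metis
    then have wV: "w \<in> V - D" using w by blast
    then have "A = orbit f w" using same A(1) w(1) self by blast
    then show "B \<in> orbit (ret f D) ` (V - D)" using ret_mem(2)[OF assms wV] A(3) wV by blast
  next
    fix B assume "B \<in> orbit (ret f D) ` (V - D)"
    then obtain w where w: "w \<in> V - D" "B = orbit f w - D" using ret_mem(2)[OF assms] by blast
    then show "B \<in> (\<lambda>A. A - D) ` {A \<in> orbit f ` V. \<not> A \<subseteq> D}" using self by blast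
  qed
qed

section \<open>Collections read off a labelled permutation\<close>

abbreviation tl_of :: "('v, 'e) pre_digraph \<Rightarrow> 'e dedge \<Rightarrow> 'v" where
  "tl_of Q \<equiv> tail (double Q)"

text \<open>The list version of \<open>read_orbit\<close>: no start is chosen, and the vertex of a
  completely cut cycle is that of the first edge of the list.\<close>

definition neck :: "('v, 'e) pre_digraph \<Rightarrow> ('z \<Rightarrow> 'e dedge) \<Rightarrow> 'z set \<Rightarrow> 'z list \<Rightarrow> ('v, 'e) necklace" where
  "neck Q lab D zs =
     (let ys = filter (\<lambda>y. y \<notin> D) zs
      in if ys = [] then Triv (tl_of Q (lab (hd zs))) else Cyc (abs_cyclic_word (map lab ys)))"

lemma abs_cyclic_word_rotate: "abs_cyclic_word (rotate k u) = abs_cyclic_word u"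
  by (metis cyclic_word.abs_eq_iff)

text \<open>Each step from a cut edge keeps the start vertex, and a cycle inside D consists of cut
  edges only.\<close>

lemma tail_const_on_cycle:
  assumes "is_cycle f zs" "set zs \<subseteq> D" "z \<in> set zs"
    and "\<And>z. z \<in> set zs \<inter> D \<Longrightarrow> tl_of Q (lab (f z)) = tl_of Q (lab z)"
  shows "tl_of Q (lab z) = tl_of Q (lab (hd zs))"
proof -
  have mem: "(f ^^ i) (hd zs) \<in> set zs" for i
    using assms(1) is_cycle_mem[OF assms(1)] by (induction i) (auto simp: is_cycle_def)
  have "tl_of Q (lab ((f ^^ i) (hd zs))) = tl_of Q (lab (hd zs))" for i
  proof (induction i)
    case (Suc i)
    have "(f ^^ i) (hd zs) \<in> set zs \<inter> D" using mem[of i] assms(2) by blast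
    then show ?case using Suc assms(4) by simp
  qed simp
  moreover obtain i where "z = (f ^^ i) (hd zs)"
    using is_cycle_funpow_hd[OF assms(1)] assms(3) by (metis (no_types, lifting) imageE list.set_map)
  ultimately show ?thesis by simp
qed

text \<open>Changing the start rotates the word, which \<open>abs_cyclic_word\<close> ignores; if
  nothing is left to read, the second assumption makes the vertex independent of the start.\<close>

lemma read_orbit_cycle:
  assumes "is_cycle f zs"
    and "\<And>z. z \<in> set zs \<inter> D \<Longrightarrow> tl_of Q (lab (f z)) = tl_of Q (lab z)"
  shows "read_orbit Q f lab D (set zs) = neck Q lab D zs"
proof -
  define z where "z = (SOME z. z \<in> set zs)"
  have z: "z \<in> set zs" unfolding z_def using assms(1) by (simp add: some_in_eq is_cycle_def)
  obtain k where k: "map (\<lambda>n. (f ^^ n) z) [0..<card (set zs)] = rotate k zs"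
    using is_cycle_funpow[OF assms(1) z] .
  obtain m where m: "filter (\<lambda>y. y \<notin> D) (rotate k zs) = rotate m (filter (\<lambda>y. y \<notin> D) zs)"
    by (rule rotate_filter)
  show ?thesis
  proof (cases "filter (\<lambda>y. y \<notin> D) zs = []")
    case True
    then have "set zs \<subseteq> D" by (auto simp: filter_empty_conv)
    then have "tl_of Q (lab z) = tl_of Q (lab (hd zs))"
      using assms(2) by (rule tail_const_on_cycle[OF assms(1) _ z])
    then show ?thesis using True m k unfolding read_orbit_def neck_def z_def[symmetric] Let_def by simp
  next
    case False
    then show ?thesis using m k unfolding read_orbit_def neck_def z_def[symmetric] Let_def
      by (simp add: rotate_map[symmetric] abs_cyclic_word_rotate)
  qed
qed

text \<open>The necklaces of \<open>cut_glue\<close> without the inherited trivial paths, over any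
  carrier. With D empty it is the collection of cyclic words spelled by the cycles of f.\<close>

definition coll :: "('v, 'e) pre_digraph \<Rightarrow> 'z set \<Rightarrow> ('z \<Rightarrow> 'z) \<Rightarrow> ('z \<Rightarrow> 'e dedge) \<Rightarrow> 'z set \<Rightarrow>
    ('v, 'e) collection" where
  "coll Q V f lab D = image_mset (read_orbit Q f lab D) (mset_set (orbit f ` V))"

text \<open>The trivial paths that arise from the completely cut orbits.\<close>

definition dead :: "('v, 'e) pre_digraph \<Rightarrow> 'z set \<Rightarrow> ('z \<Rightarrow> 'z) \<Rightarrow> ('z \<Rightarrow> 'e dedge) \<Rightarrow> 'z set \<Rightarrow>
    ('v, 'e) collection" where
  "dead Q V f lab D = image_mset (read_orbit Q f lab D) (mset_set {A \<in> orbit f ` V. A \<subseteq> D})"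

text \<open>H carries cycles of f to cycles of F with the same labels and cuts. Bijectivity is asked
  of f alone, and only on V; with H the identity, f may be replaced by a map agreeing with it on
  V.\<close>

lemma coll_image:
  assumes V: "finite V" "bij_betw f V V" and H: "inj_on H V"
    and F: "\<And>z. z \<in> V \<Longrightarrow> F (H z) = H (f z)"
    and L: "\<And>z. z \<in> V \<Longrightarrow> lab' (H z) = lab z"
    and D: "\<And>z. z \<in> V \<Longrightarrow> H z \<in> D' \<longleftrightarrow> z \<in> D"
    and t: "\<And>z. z \<in> V \<inter> D \<Longrightarrow> tl_of Q (lab (f z)) = tl_of Q (lab z)"
  shows "coll Q (H ` V) F lab' D' = coll Q V f lab D"
proof -
  have cyc: "is_cycle F (map H zs)" if "is_cycle f zs" "set zs \<subseteq> V" for zs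
  proof -
    have "map F (map H zs) = map H (map f zs)" using F that(2) by auto
    also have "\<dots> = rotate1 (map H zs)" using that(1) by (simp only: is_cycle_def rotate1_map)
    finally show ?thesis
      using that inj_on_subset[OF H that(2)] by (simp only: is_cycle_def distinct_map) simp
  qed
  have orb: "orbit F (H z) = H ` orbit f z" if "z \<in> V" for z
  proof -
    obtain zs where zs: "is_cycle f zs" "set zs \<subseteq> V" "hd zs = z" using is_cycle_exists[OF V \<open>z \<in> V\<close>] .
    then have "z \<in> set zs" by (auto simp: is_cycle_def)
    then have "orbit f z = set zs" "orbit F (H z) = set (map H zs)"
      using orbit_is_cycle[OF zs(1)] orbit_is_cycle[OF cyc[OF zs(1,2)]] by auto
    then show ?thesis by simp
  qed
  have sub: "A \<subseteq> V" if "A \<in> orbit f ` V" for A using orbit_cycle_exists[OF V that] by blast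
  have inj: "inj_on ((`) H) (orbit f ` V)"
    using sub H by (auto simp: inj_on_def[of "(`) H"] inj_on_image_eq_iff)
  have orbs: "orbit F ` H ` V = (`) H ` orbit f ` V"
    using orb by (simp add: image_image cong: image_cong)
  have "read_orbit Q F lab' D' (H ` A) = read_orbit Q f lab D A" if A: "A \<in> orbit f ` V" for A
  proof -
    obtain zs where zs: "is_cycle f zs" "set zs = A" "A \<subseteq> V" using orbit_cycle_exists[OF V A] .
    have fV: "f z \<in> V" if "z \<in> V" for z using V(2) that by (auto simp: bij_betw_def)
    have 1: "read_orbit Q f lab D (set zs) = neck Q lab D zs"
      using zs t by (intro read_orbit_cycle) auto
    have 2: "read_orbit Q F lab' D' (set (map H zs)) = neck Q lab' D' (map H zs)"
      using zs t F L D fV by (intro read_orbit_cycle cyc) (auto simp: subset_iff)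
    have 3: "filter (\<lambda>y. y \<notin> D') (map H zs) = map H (filter (\<lambda>y. y \<notin> D) zs)"
      using zs(2,3) D by (auto simp: filter_map intro!: arg_cong[of _ _ "map H"] filter_cong)
    have 4: "map lab' (map H (filter (\<lambda>y. y \<notin> D) zs)) = map lab (filter (\<lambda>y. y \<notin> D) zs)"
      using zs(2,3) L by auto
    have "zs \<noteq> []" using zs(1) by (simp add: is_cycle_def)
    then have 5: "lab' (hd (map H zs)) = lab (hd zs)" using zs(2,3) L by (cases zs) auto
    have "neck Q lab' D' (map H zs) = neck Q lab D zs"
      unfolding neck_def Let_def 3 4 5 by (simp only: map_is_Nil_conv)
    then show ?thesis using 1 2 zs(2) by simp
  qed
  then have "image_mset (\<lambda>A. read_orbit Q F lab' D' (H ` A)) (mset_set (orbit f ` V))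
      = image_mset (read_orbit Q f lab D) (mset_set (orbit f ` V))"
    using V(1) by (intro image_mset_cong) auto
  then show ?thesis
    unfolding coll_def orbs image_mset_mset_set[OF inj, symmetric] image_mset.compositionality o_def .
qed

text \<open>An orbit inside D is lost to \<open>ret f D\<close> and appears in \<open>dead\<close>;
  any other orbit A turns into \<open>A - D\<close>, and reading A without
  \<open>D \<union> D'\<close> is reading \<open>A - D\<close> without \<open>D'\<close>.\<close>

lemma coll_ret:
  assumes V: "finite V" "bij_betw f V V"
    and t: "\<And>z. z \<in> V \<inter> (D \<union> D') \<Longrightarrow> tl_of Q (lab (f z)) = tl_of Q (lab z)"
    and t': "\<And>z. z \<in> (V - D) \<inter> D' \<Longrightarrow> tl_of Q (lab (ret f D z)) = tl_of Q (lab z)"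
  shows "coll Q V f lab (D \<union> D') = coll Q (V - D) (ret f D) lab D' + dead Q V f lab D"
proof -
  let ?N = "{A \<in> orbit f ` V. \<not> A \<subseteq> D}" and ?T = "{A \<in> orbit f ` V. A \<subseteq> D}"
  have split: "mset_set (orbit f ` V) = mset_set ?N + mset_set ?T"
  proof -
    have "orbit f ` V = ?N \<union> ?T" by blast
    moreover have "mset_set (?N \<union> ?T) = mset_set ?N + mset_set ?T"
      by (rule mset_set_Union) (use V(1) in auto)
    ultimately show ?thesis by simp
  qed
  have 1: "read_orbit Q f lab (D \<union> D') A = read_orbit Q f lab D A" if "A \<in> ?T" for A
  proof -
    have A: "A \<in> orbit f ` V" using that by simp
    obtain zs where zs: "is_cycle f zs" "set zs = A" "A \<subseteq> V" using orbit_cycle_exists[OF V A] .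
    have "neck Q lab (D \<union> D') zs = neck Q lab D zs"
      using that zs(2) unfolding neck_def Let_def by (auto simp: filter_empty_conv)
    moreover have "read_orbit Q f lab (D \<union> D') (set zs) = neck Q lab (D \<union> D') zs"
      "read_orbit Q f lab D (set zs) = neck Q lab D zs"
      using zs t by (intro read_orbit_cycle; auto)+
    ultimately show ?thesis using zs(2) by simp
  qed
  have 2: "read_orbit Q f lab (D \<union> D') A = read_orbit Q (ret f D) lab D' (A - D)" if A: "A \<in> ?N" for A
  proof -
    have A': "A \<in> orbit f ` V" using A by simp
    obtain zs where zs: "is_cycle f zs" "set zs = A" "A \<subseteq> V" using orbit_cycle_exists[OF V A'] .
    define ys where "ys = filter (\<lambda>z. z \<notin> D) zs"
    have ys: "is_cycle (ret f D) ys" "set ys = A - D"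
      using is_cycle_ret[OF zs(1), of D] A zs(2) by (auto simp: ys_def)
    then have "ys \<noteq> []" by (simp add: is_cycle_def)
    have 3: "read_orbit Q f lab (D \<union> D') (set zs) = neck Q lab (D \<union> D') zs"
      using zs t by (intro read_orbit_cycle) auto
    have 4: "read_orbit Q (ret f D) lab D' (set ys) = neck Q lab D' ys"
      using ys zs t' by (intro read_orbit_cycle) auto
    have 5: "filter (\<lambda>z. z \<notin> D \<union> D') zs = filter (\<lambda>z. z \<notin> D') ys"
      unfolding ys_def by (simp add: conj_commute)
    \<comment> \<open>An orbit inside \<open>D \<union> D'\<close> but not inside D becomes trivial
      only at the second cut, where its vertex is taken from an edge outside D; this must agree with
      the vertex found in a single cut.\<close>
    have 6: "tl_of Q (lab (hd ys)) = tl_of Q (lab (hd zs))" if "filter (\<lambda>z. z \<notin> D') ys = []"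
    proof (rule tail_const_on_cycle[OF zs(1), of "D \<union> D'"])
      show "set zs \<subseteq> D \<union> D'" using that 5 by (auto simp: filter_empty_conv)
      show "hd ys \<in> set zs" using hd_in_set[OF \<open>ys \<noteq> []\<close>] ys(2) zs(2) by auto
    qed (use t zs in auto)
    have "neck Q lab (D \<union> D') zs = neck Q lab D' ys"
      unfolding neck_def Let_def 5 using 6 by auto
    then show ?thesis using 3 4 zs(2) ys(2) by simp
  qed
  note bij = orbits_ret[OF V, of D]
  have "image_mset (read_orbit Q f lab (D \<union> D')) (mset_set ?N)
      = image_mset (read_orbit Q (ret f D) lab D') (image_mset (\<lambda>A. A - D) (mset_set ?N))"
    unfolding image_mset.compositionality o_def using 2 V(1) by (intro image_mset_cong) auto
  also have "image_mset (\<lambda>A. A - D) (mset_set ?N) = mset_set (orbit (ret f D) ` (V - D))"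
    using bij by (simp add: image_mset_mset_set bij_betw_def)
  finally have N: "image_mset (read_orbit Q f lab (D \<union> D')) (mset_set ?N)
      = coll Q (V - D) (ret f D) lab D'" unfolding coll_def .
  have "image_mset (read_orbit Q f lab (D \<union> D')) (mset_set ?T) = dead Q V f lab D"
    unfolding dead_def using 1 V(1) by (intro image_mset_cong) auto
  then show ?thesis using N by (simp add: coll_def split)
qed

lemma dead_Triv:
  assumes "N \<in># dead Q V f lab D" "finite V" "bij_betw f V V"
  shows "\<exists>v. N = Triv v"
proof -
  obtain A where A: "A \<in> orbit f ` V" "A \<subseteq> D" "N = read_orbit Q f lab D A"
    using assms(1,2) unfolding dead_def by auto
  obtain zs where zs: "is_cycle f zs" "set zs = A" using orbit_cycle_exists[OF assms(2,3) A(1)] .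
  define z where "z = (SOME z. z \<in> A)"
  have "z \<in> A" unfolding z_def using zs by (auto simp: some_in_eq is_cycle_def)
  then obtain k where "map (\<lambda>n. (f ^^ n) z) [0..<card A] = rotate k zs"
    using is_cycle_funpow[OF zs(1)] zs(2) by metis
  then have "filter (\<lambda>y. y \<notin> D) (map (\<lambda>n. (f ^^ n) z) [0..<card A]) = []"
    using A(2) zs(2) by (auto simp: filter_empty_conv)
  then show ?thesis using A(3) unfolding read_orbit_def Let_def z_def by auto
qed

text \<open>A cycle inside D involves the map only on D, so the carrier and the map may change
  elsewhere. Thus the trivial paths created by the first gluing are the same whether two or all
  three collections are considered.\<close>

lemma dead_cong:
  assumes V: "finite V" "bij_betw f V V" and W: "finite W" "bij_betw g W W" and "D \<subseteq> V" "D \<subseteq> W"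
    and eq: "\<And>z. z \<in> D \<Longrightarrow> g z = f z"
    and t: "\<And>z. z \<in> D \<Longrightarrow> tl_of Q (lab (f z)) = tl_of Q (lab z)"
  shows "dead Q W g lab D = dead Q V f lab D"
proof -
  have mono: "A \<in> orbit k ` B \<and> read_orbit Q h lab D A = read_orbit Q k lab D A"
    if A: "A \<in> orbit h ` C" "A \<subseteq> D" "D \<subseteq> B" and C: "finite C" "bij_betw h C C"
      and eq: "\<And>z. z \<in> D \<Longrightarrow> h z = k z" and t: "\<And>z. z \<in> D \<Longrightarrow> tl_of Q (lab (h z)) = tl_of Q (lab z)"
    for A h k and B C
  proof -
    obtain zs where zs: "is_cycle h zs" "set zs = A" using orbit_cycle_exists[OF C A(1)] .
    have zk: "is_cycle k zs" using is_cycle_cong[of zs h k] zs A(2) eq by blast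
    have hd: "hd zs \<in> set zs" using zs(1) by (simp add: is_cycle_def)
    have "A = orbit k (hd zs)" using orbit_is_cycle[OF zk hd] zs(2) by simp
    moreover have "hd zs \<in> B" using hd zs(2) A(2,3) by blast
    moreover have "read_orbit Q h lab D (set zs) = neck Q lab D zs"
      by (rule read_orbit_cycle[OF zs(1)]) (use t in auto)
    moreover have "read_orbit Q k lab D (set zs) = neck Q lab D zs"
      by (rule read_orbit_cycle[OF zk]) (use t eq in auto)
    ultimately show ?thesis using zs(2) by auto
  qed
  have "{A \<in> orbit g ` W. A \<subseteq> D} = {A \<in> orbit f ` V. A \<subseteq> D}"
    using mono[where h = g and C = W and B = V and k = f] mono[where h = f and C = V and B = W and k = g]
      assms by auto
  moreover have "read_orbit Q g lab D A = read_orbit Q f lab D A" if "A \<in> {A \<in> orbit f ` V. A \<subseteq> D}" for A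
    using mono[where h = f and C = V and B = W and k = g] that assms by auto
  ultimately show ?thesis using V(1) unfolding dead_def by (auto intro!: image_mset_cong)
qed

text \<open>The start points may differ: after equal first steps both walks stay in D, where the
  maps agree, until their common exit. In use, \<open>w'\<close> is the partner of w under the
  second matching, and k shows that the exit exists.\<close>

lemma ret_cong:
  assumes "(F ^^ Suc k) w \<notin> D" "F w = g w'" "\<And>z. z \<in> D \<Longrightarrow> F z = g z"
  shows "ret F D w = ret g D w'"
proof -
  define m where "m = (LEAST k. (F ^^ Suc k) w \<notin> D)"
  have m: "(F ^^ Suc m) w \<notin> D" unfolding m_def by (rule LeastI) (rule assms(1))
  have less: "(F ^^ Suc j) w \<in> D" if "j < m" for j
    using not_less_Least[of j "\<lambda>k. (F ^^ Suc k) w \<notin> D"] that unfolding m_def by blast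
  have eq: "(F ^^ Suc j) w = (g ^^ Suc j) w'" if "j \<le> m" for j
    using that
  proof (induction j)
    case (Suc j)
    have "(F ^^ Suc j) w \<in> D" by (rule less) (use Suc.prems in simp)
    then have "F ((F ^^ Suc j) w) = g ((F ^^ Suc j) w)" by (rule assms(3))
    moreover have "(F ^^ Suc j) w = (g ^^ Suc j) w'" by (rule Suc.IH) (use Suc.prems in simp)
    ultimately show ?case by simp
  qed (simp add: assms(2))
  have "(LEAST k. (g ^^ Suc k) w' \<notin> D) = m"
  proof (rule Least_equality)
    show "(g ^^ Suc m) w' \<notin> D" using m eq[of m] by simp
    show "m \<le> y" if "(g ^^ Suc y) w' \<notin> D" for y
      using that less[of y] eq[of y] by (cases "m \<le> y") auto
  qed
  then show ?thesis unfolding ret_def m_def[symmetric] using eq[of m] by simp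
qed

text \<open>Periodicity supplies the witness that a walk from a point outside D leaves D: it comes
  back to that point.\<close>

lemma returns:
  assumes "finite V" "bij_betw f V V" "w \<in> V"
  obtains k where "(f ^^ Suc k) w = w"
proof -
  obtain zs where zs: "is_cycle f zs" "hd zs = w" using is_cycle_exists[OF assms] by blast
  then have "zs \<noteq> []" by (simp add: is_cycle_def)
  then obtain k where k: "length zs = Suc k" by (cases zs) auto
  have "(f ^^ length zs) (zs ! 0) = zs ! 0"
    using is_cycle_funpow_nth[OF zs(1), of 0 "length zs"] \<open>zs \<noteq> []\<close> by simp
  then show ?thesis using that[of k] k zs(2) \<open>zs \<noteq> []\<close> by (metis hd_conv_nth)
qed

section \<open>Matchings\<close>

text \<open>Symmetrising forbids two partners for an edge, on whichever side it occurs; the pairs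
  themselves stay ordered because \<open>weight\<close> distinguishes the components.\<close>

definition matching :: "('a \<times> 'a) set \<Rightarrow> bool" where
  "matching M \<longleftrightarrow> single_valued (M \<union> M\<inverse>)"

text \<open>Fixing the edges outside \<open>Field M\<close> merges the two cases of
  \<open>glue_perm\<close> into the single permutation \<open>n \<circ> mate M\<close>.\<close>

definition mate :: "('a \<times> 'a) set \<Rightarrow> 'a \<Rightarrow> 'a" where
  "mate M z = (if z \<in> Field M then THE y. (z, y) \<in> M \<union> M\<inverse> else z)"

lemma mate_eq: "matching M \<Longrightarrow> (a, b) \<in> M \<union> M\<inverse> \<Longrightarrow> mate M a = b"
  unfolding matching_def mate_def by (auto simp: Field_def single_valued_def intro!: the_equality)

lemma mate_outside: "z \<notin> Field M \<Longrightarrow> mate M z = z"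
  by (simp add: mate_def)

lemma mate_in: "matching M \<Longrightarrow> z \<in> Field M \<Longrightarrow> (z, mate M z) \<in> M \<union> M\<inverse>"
  using mate_eq[of M z] unfolding Field_def by blast

lemma mate_mate: "matching M \<Longrightarrow> mate M (mate M z) = z"
  by (cases "z \<in> Field M") (auto simp: mate_outside dest!: mate_in intro!: mate_eq)

lemma mate_Field: "matching M \<Longrightarrow> z \<in> Field M \<Longrightarrow> mate M z \<in> Field M"
  using mate_in[of M z] by (auto simp: Field_def)

lemma bij_betw_mate:
  assumes "matching M" "Field M \<subseteq> V"
  shows "bij_betw (mate M) V V"
proof (rule bij_betw_byWitness[where f' = "mate M"])
  have "mate M z \<in> V" if "z \<in> V" for z
    using mate_Field[OF assms(1), of z] mate_outside[of z M] assms(2) that by (cases "z \<in> Field M") auto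
  then show "mate M ` V \<subseteq> V" "mate M ` V \<subseteq> V" by auto
qed (auto simp: mate_mate[OF assms(1)])

lemma mate_Un:
  assumes "matching (M1 \<union> M2)" "Field M1 \<inter> Field M2 = {}"
  shows "z \<notin> Field M2 \<Longrightarrow> mate (M1 \<union> M2) z = mate M1 z"
    and "z \<notin> Field M1 \<Longrightarrow> mate (M1 \<union> M2) z = mate M2 z"
proof -
  have F: "Field (M1 \<union> M2) = Field M1 \<union> Field M2" by (auto simp: Field_def)
  have m: "matching M1" "matching M2" using assms(1) unfolding matching_def single_valued_def by blast+
  have in1: "mate (M1 \<union> M2) z = mate M1 z" if "z \<in> Field M1" for z
    using mate_in[OF m(1) that] by (intro mate_eq[OF assms(1)]) auto
  have in2: "mate (M1 \<union> M2) z = mate M2 z" if "z \<in> Field M2" for z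
    using mate_in[OF m(2) that] by (intro mate_eq[OF assms(1)]) auto
  show "mate (M1 \<union> M2) z = mate M1 z" if "z \<notin> Field M2"
    using that in1 by (cases "z \<in> Field M1") (auto simp: mate_outside F)
  show "mate (M1 \<union> M2) z = mate M2 z" if "z \<notin> Field M1"
    using that in2 by (cases "z \<in> Field M2") (auto simp: mate_outside F)
qed

lemma matching_Un:
  assumes "Field M1 \<inter> Field M2 = {}"
  shows "matching (M1 \<union> M2) \<longleftrightarrow> matching M1 \<and> matching M2"
  using assms unfolding matching_def single_valued_def Field_def by blast

definition labelled :: "('a \<Rightarrow> 'e dedge) \<Rightarrow> ('a \<times> 'a) set \<Rightarrow> bool" where
  "labelled lab M \<longleftrightarrow> (\<forall>(a, b) \<in> M. lab b = rev_edge (lab a))"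

text \<open>
  Closedness of the words, which makes the start vertex of a completely cut orbit independent of the
  edge that \<^const>\<open>read_orbit\<close> picks.
\<close>

definition walks :: "('v, 'e) pre_digraph \<Rightarrow> 'z set \<Rightarrow> ('z \<Rightarrow> 'z) \<Rightarrow> ('z \<Rightarrow> 'e dedge) \<Rightarrow> bool" where
  "walks Q V f lab \<longleftrightarrow> (\<forall>z \<in> V. tail (double Q) (lab (f z)) = head (double Q) (lab z))"

lemma rev_rev_edge [simp]: "rev_edge (rev_edge a) = a"
  by (cases a) auto

lemma head_rev_edge [simp]: "head (double Q) (rev_edge a) = tail (double Q) a"
  by (cases a) (auto simp: double_def)

text \<open>A cut edge labelled a is replaced by one labelled \<open>rev_edge a\<close>, whose head
  is the tail of a; closedness of the words then makes the next edge start where a starts.\<close>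

lemma tail_glued:
  assumes "matching M" "labelled lab M" "walks Q V n lab" "Field M \<subseteq> V" "z \<in> V"
  shows "tl_of Q (lab (n (mate M z))) = (if z \<in> Field M then tl_of Q (lab z) else head (double Q) (lab z))"
proof (cases "z \<in> Field M")
  case True
  have "lab (mate M z) = rev_edge (lab z)"
    using mate_in[OF assms(1) True] assms(2) by (auto simp: labelled_def)
  moreover have "mate M z \<in> V" using mate_Field[OF assms(1) True] assms(4) by blast
  ultimately show ?thesis using assms(3) True by (simp add: walks_def)
next
  case False
  then show ?thesis using assms(3,5) by (simp add: walks_def mate_outside)
qed

text \<open>All intermediate points of a first return lie in D, where f preserves the start vertex,
  so only the first step counts.\<close>

lemma tail_ret:
  assumes "finite V" "bij_betw f V V" "w \<in> V - D"
    and "\<And>z. z \<in> V \<inter> D \<Longrightarrow> tl_of Q (lab (f z)) = tl_of Q (lab z)"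
  shows "tl_of Q (lab (ret f D w)) = tl_of Q (lab (f w))"
proof -
  obtain k where "(f ^^ Suc k) w = w" using returns[OF assms(1,2)] assms(3) by blast
  then have k: "(f ^^ Suc k) w \<notin> D" using assms(3) by simp
  define m where "m = (LEAST k. (f ^^ Suc k) w \<notin> D)"
  have less: "(f ^^ Suc j) w \<in> D" if "j < m" for j
    using not_less_Least[of j "\<lambda>k. (f ^^ Suc k) w \<notin> D"] that unfolding m_def by blast
  have mem: "(f ^^ j) w \<in> V" for j
    using assms(2,3) by (intro funpow_mem) (auto simp: bij_betw_def)
  have "tl_of Q (lab ((f ^^ Suc j) w)) = tl_of Q (lab (f w))" if "j \<le> m" for j
    using that
  proof (induction j)
    case (Suc j)
    have "(f ^^ Suc j) w \<in> D" by (rule less) (use Suc.prems in simp)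
    then have "(f ^^ Suc j) w \<in> V \<inter> D" using mem by blast
    then have "tl_of Q (lab (f ((f ^^ Suc j) w))) = tl_of Q (lab ((f ^^ Suc j) w))" by (rule assms(4))
    then show ?case using Suc by simp
  qed simp
  then show ?thesis unfolding ret_def m_def[symmetric] by simp
qed

text \<open>The words of the glued collection are closed again, which is what a second gluing
  requires.\<close>

lemma walks_ret:
  assumes "finite V" "bij_betw n V V" "matching M" "labelled lab M" "walks Q V n lab" "Field M \<subseteq> V"
  shows "walks Q (V - Field M) (ret (n \<circ> mate M) (Field M)) lab"
proof -
  have bij: "bij_betw (n \<circ> mate M) V V" using bij_betw_trans[OF bij_betw_mate[OF assms(3,6)] assms(2)] .
  have "tl_of Q (lab (ret (n \<circ> mate M) (Field M) w)) = tl_of Q (lab ((n \<circ> mate M) w))"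
    if "w \<in> V - Field M" for w
    by (rule tail_ret[OF assms(1) bij that]) (use tail_glued[OF assms(3-6)] in auto)
  then show ?thesis unfolding walks_def using tail_glued[OF assms(3-6)] by auto
qed

text \<open>\<open>coll_ret\<close> with \<open>D = Field M1\<close> is applied to the simultaneous
  gluing; it remains to express its return map and its dead cycles through M1. B stands for the
  edges of the two collections glued first, so the dead cycles are taken in B.\<close>

lemma coll_glue_twice:
  assumes V: "finite V" "bij_betw n V V" "B \<subseteq> V" "bij_betw n B B"
    and M1: "Field M1 \<subseteq> B" and M2: "Field M2 \<subseteq> V" and disj: "Field M1 \<inter> Field M2 = {}"
    and m: "matching (M1 \<union> M2)" and lab: "labelled lab (M1 \<union> M2)" and w: "walks Q V n lab"
  shows "coll Q V (n \<circ> mate (M1 \<union> M2)) lab (Field (M1 \<union> M2))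
    = coll Q (V - Field M1) (ret (n \<circ> mate M1) (Field M1) \<circ> mate M2) lab (Field M2)
      + dead Q B (n \<circ> mate M1) lab (Field M1)"
proof -
  let ?F = "n \<circ> mate (M1 \<union> M2)" and ?g = "n \<circ> mate M1" and ?D = "Field M1"
  have F12: "Field (M1 \<union> M2) = Field M1 \<union> Field M2" by (auto simp: Field_def)
  have mm: "matching M1" "matching M2" using m matching_Un[OF disj] by auto
  have l1: "labelled lab M1" using lab by (auto simp: labelled_def)
  have FV: "Field (M1 \<union> M2) \<subseteq> V" using F12 M1 M2 V(3) by auto
  have bF: "bij_betw ?F V V" using bij_betw_trans[OF bij_betw_mate[OF m FV] V(2)] .
  have bg: "bij_betw ?g V V" using M1 V(3) by (intro bij_betw_trans[OF bij_betw_mate[OF mm(1)] V(2)]) auto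
  have bgB: "bij_betw ?g B B" using M1 by (intro bij_betw_trans[OF bij_betw_mate[OF mm(1)] V(4)]) auto
  have tF: "tl_of Q (lab (?F z)) = (if z \<in> Field M1 \<union> Field M2 then tl_of Q (lab z) else head (double Q) (lab z))"
    if "z \<in> V" for z using tail_glued[OF m lab w FV that] F12 by simp
  have tR: "tl_of Q (lab (ret ?F ?D z)) = tl_of Q (lab z)" if "z \<in> (V - ?D) \<inter> Field M2" for z
  proof -
    have "tl_of Q (lab (ret ?F ?D z)) = tl_of Q (lab (?F z))"
      by (rule tail_ret[OF V(1) bF]) (use tF that in auto)
    then show ?thesis using tF[of z] that by auto
  qed
  have eqD: "?F z = ?g z" if "z \<in> ?D" for z
  proof -
    have "z \<notin> Field M2" using that disj by blast
    then show ?thesis using mate_Un(1)[OF m disj] by simp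
  qed
  have mateW: "mate M2 z \<in> V - ?D" if "z \<in> V - ?D" for z
    using that mate_Field[OF mm(2), of z] mate_outside[of z M2] M2 disj by (cases "z \<in> Field M2") auto
  \<comment> \<open>Outside \<open>Field M1\<close> the combined map first passes to the partner
    under M2 and then steps like \<open>n \<circ> mate M1\<close>; inside \<open>Field M1\<close>
    there are no partners under M2.\<close>
  have retW: "ret ?F ?D z = (ret ?g ?D \<circ> mate M2) z" if z: "z \<in> V - ?D" for z
  proof -
    obtain k where "(?F ^^ Suc k) z = z" using returns[OF V(1) bF] z by blast
    then have "(?F ^^ Suc k) z \<notin> ?D" using z by auto
    moreover have "?F z = ?g (mate M2 z)"
      using mate_Un(2)[OF m disj, of z] mateW[OF z] z by (simp add: mate_outside)
    ultimately show ?thesis using eqD by (auto intro!: ret_cong)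
  qed
  have "coll Q V ?F lab (?D \<union> Field M2) = coll Q (V - ?D) (ret ?F ?D) lab (Field M2) + dead Q V ?F lab ?D"
    by (rule coll_ret[OF V(1) bF]) (use tF tR in auto)
  also have "dead Q V ?F lab ?D = dead Q B ?g lab ?D"
  proof (rule dead_cong[OF finite_subset[OF V(3,1)] bgB V(1) bF M1 subset_trans[OF M1 V(3)] eqD])
    fix z assume "z \<in> ?D"
    then show "tl_of Q (lab (?g z)) = tl_of Q (lab z)"
      using tF[of z] eqD[of z] M1 V(3) by auto
  qed
  also have "coll Q (V - ?D) (ret ?F ?D) lab (Field M2) = coll Q (V - ?D) (ret ?g ?D \<circ> mate M2) lab (Field M2)"
    using coll_image[of "V - ?D" "ret ?F ?D" "\<lambda>z. z" "ret ?g ?D \<circ> mate M2" lab lab "Field M2" "Field M2" Q]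
      V(1) bij_betw_ret[OF V(1) bF] retW tR by simp
  finally show ?thesis unfolding F12 .
qed

section \<open>Abstract edges as a labelled permutation\<close>

text \<open>Isomorphism of labelled permutations: what is left of the abstract edges once the
  arbitrary order and first letters chosen by \<open>words\<close> are disregarded.\<close>

definition cyc_iso :: "(nat \<times> nat \<Rightarrow> 'z) \<Rightarrow> 'e dedge list list \<Rightarrow> 'z set \<Rightarrow> ('z \<Rightarrow> 'z) \<Rightarrow> ('z \<Rightarrow> 'e dedge) \<Rightarrow> bool"
  where "cyc_iso g ws W n lab \<longleftrightarrow> bij_betw g (abs_edges ws) W \<and>
    (\<forall>e \<in> abs_edges ws. n (g e) = g (next_edge ws e) \<and> lab (g e) = pr ws e)"

lemma finite_abs_edges: "finite (abs_edges ws)"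
proof -
  have "abs_edges ws = (SIGMA i:{..<length ws}. {..<length (ws ! i)})" by (auto simp: abs_edges_def)
  then show ?thesis by simp
qed

lemma next_edge_in: "e \<in> abs_edges ws \<Longrightarrow> next_edge ws e \<in> abs_edges ws"
  by (auto simp: abs_edges_def next_edge_def intro!: mod_less_divisor)

lemma image_mset_eq_mset:
  assumes "image_mset f M = mset ys"
  obtains xs where "mset xs = M" "map f xs = ys"
proof -
  have "\<exists>xs. mset xs = M \<and> map f xs = ys"
    using assms
  proof (induction ys arbitrary: M)
    case (Cons y ys)
    then have "image_mset f M = add_mset y (mset ys)" by simp
    then obtain x N where "M = add_mset x N" "y = f x" "mset ys = image_mset f N"
      by (auto dest: msed_map_invR)
    then show ?case using Cons.IH[of N] by (metis list.simps(9) mset.simps(2))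
  qed simp
  then show ?thesis using that by blast
qed

lemma read_orbit_uncut:
  assumes "is_cycle f zs"
  shows "read_orbit Q f lab {} (set zs) = Cyc (abs_cyclic_word (map lab zs))"
proof -
  have "read_orbit Q f lab {} (set zs) = neck Q lab {} zs"
    by (rule read_orbit_cycle[OF assms]) simp
  then show ?thesis using assms by (simp add: neck_def is_cycle_def)
qed

text \<open>Equal multisets of necklaces allow the orbits to be listed in the order of ws; each
  cycle is then rotated until it spells its word letter by letter, and \<open>g\<close> sends (i, j)
  to the j-th entry of the i-th cycle.\<close>

lemma cyc_iso_exists:
  assumes W: "finite W" "bij_betw n W W"
    and eq: "coll Q W n lab {} = image_mset (\<lambda>w. Cyc (abs_cyclic_word w)) (mset ws)"
  obtains g where "cyc_iso g ws W n lab"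
proof -
  have "image_mset (read_orbit Q n lab {}) (mset_set (orbit n ` W))
      = mset (map (\<lambda>w. Cyc (abs_cyclic_word w)) ws)"
    using eq by (simp add: coll_def)
  then obtain Os where Os: "mset Os = mset_set (orbit n ` W)"
    "map (read_orbit Q n lab {}) Os = map (\<lambda>w. Cyc (abs_cyclic_word w)) ws"
    by (rule image_mset_eq_mset)
  have len: "length Os = length ws" using Os(2) by (metis length_map)
  have set_Os: "set Os = orbit n ` W"
    using arg_cong[OF Os(1), of set_mset] W(1) by simp
  have dist: "distinct Os"
    using arg_cong[OF Os(1), of size] set_Os by (intro card_distinct) simp
  have "\<exists>zs. is_cycle n zs \<and> set zs = Os ! i \<and> map lab zs = ws ! i" if i: "i < length ws" for i
  proof -
    have "Os ! i \<in> orbit n ` W" using i len set_Os by (metis nth_mem)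
    then obtain zs where zs: "is_cycle n zs" "set zs = Os ! i"
      using orbit_cycle_exists[OF W] by metis
    have "Cyc (abs_cyclic_word (map lab zs)) = (Cyc (abs_cyclic_word (ws ! i)) :: ('a, 'c) necklace)"
      using arg_cong[OF Os(2), of "\<lambda>xs. xs ! i"] i len read_orbit_uncut[OF zs(1), of Q lab] zs(2) by simp
    then obtain k where "ws ! i = rotate k (map lab zs)"
      by (auto simp: cyclic_word.abs_eq_iff)
    then have "map lab (rotate k zs) = ws ! i" by (simp add: rotate_map)
    then show ?thesis using is_cycle_rotate[OF zs(1)] zs(2) by (metis set_rotate)
  qed
  then obtain zl where zl: "\<And>i. i < length ws \<Longrightarrow> is_cycle n (zl i)"
    "\<And>i. i < length ws \<Longrightarrow> set (zl i) = Os ! i" "\<And>i. i < length ws \<Longrightarrow> map lab (zl i) = ws ! i" by metis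
  have lz: "length (zl i) = length (ws ! i)" if "i < length ws" for i using zl(3)[OF that] by (metis length_map)
  define g where "g = (\<lambda>(i, j). zl i ! j)"
  have "inj_on g (abs_edges ws)"
  proof (rule inj_onI)
    fix e e' assume e: "e \<in> abs_edges ws" and e': "e' \<in> abs_edges ws" and eq: "g e = g e'"
    obtain i j i' j' where ij: "e = (i, j)" "e' = (i', j')" by (metis surj_pair)
    have b: "i < length ws" "j < length (zl i)" "i' < length ws" "j' < length (zl i')"
      using e e' lz by (auto simp: ij abs_edges_def)
    then have "zl i ! j \<in> Os ! i" "zl i ! j \<in> Os ! i'"
      using zl(2) eq nth_mem unfolding ij g_def by (metis case_prod_conv)+
    then have "Os ! i = Os ! i'"
      using orbit_is_cycle[OF zl(1)[OF b(1)]] orbit_is_cycle[OF zl(1)[OF b(3)]] zl(2) b by metis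
    then have "i = i'" using b dist len by (simp add: nth_eq_iff_index_eq)
    moreover have "j = j'"
      using eq b zl(1)[OF b(1)] \<open>i = i'\<close> by (simp add: ij g_def is_cycle_def nth_eq_iff_index_eq)
    ultimately show "e = e'" by (simp add: ij)
  qed
  moreover have "g ` abs_edges ws = W"
  proof (intro equalityI subsetI)
    fix w assume "w \<in> g ` abs_edges ws"
    then obtain i j where ij: "i < length ws" "j < length (zl i)" "w = zl i ! j"
      using lz by (auto simp: g_def abs_edges_def)
    then have w: "w \<in> Os ! i" using zl(2) nth_mem by metis
    have "Os ! i \<in> orbit n ` W" using ij(1) len set_Os by (metis nth_mem)
    then show "w \<in> W" using orbit_cycle_exists[OF W] w by (metis subsetD)
  next
    fix w assume w: "w \<in> W"
    then obtain zs where zs: "is_cycle n zs" "hd zs = w" using is_cycle_exists[OF W] by metis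
    have "w \<in> set zs" using zs by (auto simp: is_cycle_def)
    then have "w \<in> orbit n w" using orbit_is_cycle[OF zs(1)] by simp
    moreover obtain i where i: "i < length ws" "Os ! i = orbit n w"
      using set_Os w len by (metis imageI in_set_conv_nth)
    ultimately have "w \<in> set (zl i)" using zl(2) by simp
    then obtain j where "j < length (zl i)" "w = zl i ! j" by (metis in_set_conv_nth)
    then show "w \<in> g ` abs_edges ws"
      using i lz by (auto simp: g_def abs_edges_def intro!: image_eqI[of _ _ "(i, j)"])
  qed
  moreover have "n (g e) = g (next_edge ws e) \<and> lab (g e) = pr ws e" if e: "e \<in> abs_edges ws" for e
  proof -
    obtain i j where ij: "e = (i, j)" "i < length ws" "j < length (zl i)"
      using e lz by (auto simp: abs_edges_def)
    have "n (zl i ! j) = map n (zl i) ! j" using ij by simp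
    also have "\<dots> = zl i ! (Suc j mod length (zl i))"
      using zl(1)[OF ij(2)] ij(3) by (simp add: is_cycle_def nth_rotate1)
    finally have "n (g e) = g (next_edge ws e)"
      using ij lz by (simp add: g_def next_edge_def)
    moreover have "lab (g e) = pr ws e"
      using ij zl(3)[OF ij(2)] by (auto simp: g_def pr_def dest: arg_cong[of _ _ "\<lambda>xs. xs ! j"])
    ultimately show ?thesis by blast
  qed
  ultimately have "cyc_iso g ws W n lab" by (simp add: cyc_iso_def bij_betw_def)
  then show ?thesis using that by blast
qed

lemma coll_uncut_Cyc:
  assumes "N \<in># coll Q W n lab {}" "finite W" "bij_betw n W W"
  shows "\<nexists>v. N = Triv v"
proof -
  obtain A where A: "A \<in> orbit n ` W" "N = read_orbit Q n lab {} A"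
    using assms(1,2) by (auto simp: coll_def)
  obtain zs where "is_cycle n zs" "set zs = A" using orbit_cycle_exists[OF assms(2,3) A(1)] .
  then show ?thesis using A(2) read_orbit_uncut[of n zs Q lab] by auto
qed

text \<open>Uncut cycles never read as trivial paths, so both summands can be recovered from the sum
  by filtering.\<close>

lemma collection_parts:
  assumes W: "finite W" "bij_betw n W W" and T: "\<And>N. N \<in># T \<Longrightarrow> \<exists>v. N = Triv v"
  shows "trivials (coll Q W n lab {} + T) = T"
    and "\<exists>g. cyc_iso g (words (coll Q W n lab {} + T)) W n lab"
proof -
  let ?C = "coll Q W n lab {}"
  have C: "\<nexists>v. N = Triv v" if "N \<in># ?C" for N using coll_uncut_Cyc[OF that W] .
  have "filter_mset (\<lambda>N. \<exists>v. N = Triv v) ?C = {#}" using C by simp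
  moreover have "filter_mset (\<lambda>N. \<exists>v. N = Triv v) T = T" using T by (simp add: filter_mset_eq_conv)
  ultimately show "trivials (?C + T) = T" by (simp add: trivials_def)
  have "filter_mset (\<lambda>N. \<nexists>v. N = Triv v) ?C = ?C" using C by (simp add: filter_mset_eq_conv)
  moreover have "filter_mset (\<lambda>N. \<nexists>v. N = Triv v) T = {#}" using T by simp
  ultimately have "?C = image_mset (\<lambda>w. Cyc (abs_cyclic_word w)) (mset (words (?C + T)))"
    by (simp add: mset_words)
  then show "\<exists>g. cyc_iso g (words (?C + T)) W n lab" using cyc_iso_exists[OF W] by metis
qed

section \<open>The product as a sum over matchings\<close>

definition pairs :: "('z \<Rightarrow> 'e dedge) \<Rightarrow> 'z set \<Rightarrow> 'z set \<Rightarrow> ('z \<times> 'z) set" where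
  "pairs lab X Y = {(x, y) \<in> X \<times> Y. lab y = rev_edge (lab x)}"

definition matches :: "('z \<times> 'z) set \<Rightarrow> ('z \<times> 'z) set set" where
  "matches E = {M. M \<subseteq> E \<and> matching M}"

text \<open>The sign of the product counts the edges cut in the right factor that lie over Q; with
  pairs ordered from left factor to right, these are the second components.\<close>

definition weight :: "('v, 'e) pre_digraph \<Rightarrow> ('z \<Rightarrow> 'e dedge) \<Rightarrow> ('z \<times> 'z) set \<Rightarrow> 'k::field_char_0" where
  "weight Q lab M = (-1) ^ card {p \<in> M. lab (snd p) \<in> Orig ` arcs Q} / 2 ^ card M"

definition mterm :: "('v, 'e) pre_digraph \<Rightarrow> ('z \<Rightarrow> 'e dedge) \<Rightarrow> ('v, 'e) collection \<Rightarrow> ('z \<times> 'z) set \<Rightarrow>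
    (('v, 'e) collection \<Rightarrow>\<^sub>0 'k::field_char_0) poly" where
  "mterm Q lab K M = monom (Poly_Mapping.single K (weight Q lab M)) (card M)"

definition edge_pairs :: "(nat \<times> nat \<Rightarrow> 'z) \<Rightarrow> (nat \<times> nat \<Rightarrow> 'z) \<Rightarrow> (nat \<times> nat) set \<times> (nat \<times> nat) set \<times> (nat \<times> nat \<Rightarrow> nat \<times> nat)
    \<Rightarrow> ('z \<times> 'z) set" where
  "edge_pairs g1 g2 = (\<lambda>(IX, IY, \<phi>). (\<lambda>x. (g1 x, g2 (\<phi> x))) ` IX)"

text \<open>A gluing is the graph of \<phi>. Disjointness of X and Y keeps the symmetrised graph
  single valued; extensionality makes \<phi> recoverable from its graph.\<close>

lemma bij_betw_edge_pairs:
  assumes 1: "cyc_iso g1 (words P) X n lab" and 2: "cyc_iso g2 (words R) Y n lab" and XY: "X \<inter> Y = {}"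
  shows "bij_betw (edge_pairs g1 g2) (gluings P R) (matches (pairs lab X Y))"
proof (rule bij_betw_imageI)
  let ?A = "abs_edges (words P)" and ?B = "abs_edges (words R)"
  have g1: "inj_on g1 ?A" "g1 ` ?A = X" and l1: "\<And>e. e \<in> ?A \<Longrightarrow> lab (g1 e) = pr (words P) e"
    using 1 by (auto simp: cyc_iso_def bij_betw_def)
  have g2: "inj_on g2 ?B" "g2 ` ?B = Y" and l2: "\<And>e. e \<in> ?B \<Longrightarrow> lab (g2 e) = pr (words R) e"
    using 2 by (auto simp: cyc_iso_def bij_betw_def)
  show "inj_on (edge_pairs g1 g2) (gluings P R)"
  proof (rule inj_onI)
    fix a b assume a: "a \<in> gluings P R" and b: "b \<in> gluings P R" and eq: "edge_pairs g1 g2 a = edge_pairs g1 g2 b"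
    obtain IX IY \<phi> IX' IY' \<phi>' where ab: "a = (IX, IY, \<phi>)" "b = (IX', IY', \<phi>')" by (metis surj_pair)
    have A: "IX \<subseteq> ?A" "\<phi> \<in> extensional IX" "bij_betw \<phi> IX IY" "IY \<subseteq> ?B" using a by (auto simp: ab gluings_def)
    have B: "IX' \<subseteq> ?A" "\<phi>' \<in> extensional IX'" "bij_betw \<phi>' IX' IY'" "IY' \<subseteq> ?B" using b by (auto simp: ab gluings_def)
    have key: "x \<in> J' \<and> \<psi> x = \<psi>' x"
      if "(\<lambda>x. (g1 x, g2 (\<psi> x))) ` J = (\<lambda>x. (g1 x, g2 (\<psi>' x))) ` J'" "x \<in> J" "J \<subseteq> ?A" "J' \<subseteq> ?A"
        "\<psi> ` J \<subseteq> ?B" "\<psi>' ` J' \<subseteq> ?B" for x J J' \<psi> \<psi>'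
    proof -
      have "(g1 x, g2 (\<psi> x)) \<in> (\<lambda>x. (g1 x, g2 (\<psi>' x))) ` J'" using that(1,2) by blast
      then obtain x' where x': "x' \<in> J'" "g1 x = g1 x'" "g2 (\<psi> x) = g2 (\<psi>' x')" by auto
      then have "x = x'" using that g1(1) by (auto dest: inj_onD)
      moreover have "\<psi> x \<in> ?B" "\<psi>' x' \<in> ?B" using that x'(1) by auto
      ultimately show ?thesis using x' inj_onD[OF g2(1)] by metis
    qed
    have im: "\<phi> ` IX \<subseteq> ?B" "\<phi>' ` IX' \<subseteq> ?B" using A B by (auto simp: bij_betw_def)
    have e: "(\<lambda>x. (g1 x, g2 (\<phi> x))) ` IX = (\<lambda>x. (g1 x, g2 (\<phi>' x))) ` IX'"
      using eq by (simp add: ab edge_pairs_def)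
    have IX: "IX = IX'" using key[OF e _ A(1) B(1) im] key[OF e[symmetric] _ B(1) A(1) im(2,1)] by blast
    moreover have "\<phi> = \<phi>'"
      using A(2) B(2) key[OF e _ A(1) B(1) im] unfolding IX by (auto intro: extensionalityI)
    ultimately show "a = b" using A(3) B(3) by (auto simp: ab bij_betw_def)
  qed
  show "edge_pairs g1 g2 ` gluings P R = matches (pairs lab X Y)"
  proof (intro equalityI subsetI)
    fix M assume "M \<in> edge_pairs g1 g2 ` gluings P R"
    then obtain IX IY \<phi> where M: "M = (\<lambda>x. (g1 x, g2 (\<phi> x))) ` IX" and A: "IX \<subseteq> ?A" "inj_on \<phi> IX" "\<phi> ` IX \<subseteq> ?B"
      and r: "\<And>x. x \<in> IX \<Longrightarrow> pr (words R) (\<phi> x) = rev_edge (pr (words P) x)"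
      by (auto simp: edge_pairs_def gluings_def bij_betw_def)
    have "(g1 x, g2 (\<phi> x)) \<in> pairs lab X Y" if x: "x \<in> IX" for x
    proof -
      have "x \<in> ?A" "\<phi> x \<in> ?B" using A x by auto
      then show ?thesis using r[OF x] l1[of x] l2[of "\<phi> x"] g1(2) g2(2) by (auto simp: pairs_def)
    qed
    then have "M \<subseteq> pairs lab X Y" unfolding M by blast
    moreover have "matching M"
    proof -
      have inj: "g1 x \<noteq> g2 (\<phi> y)" "g1 x = g1 y \<longleftrightarrow> x = y" "g2 (\<phi> x) = g2 (\<phi> y) \<longleftrightarrow> x = y"
        if "x \<in> IX" "y \<in> IX" for x y
      proof -
        have "g1 x \<in> X" "g2 (\<phi> y) \<in> Y" using that A g1(2) g2(2) by auto
        then show "g1 x \<noteq> g2 (\<phi> y)" using XY by auto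
        show "g1 x = g1 y \<longleftrightarrow> x = y" using g1(1) A(1) that by (auto dest: inj_onD)
        have "g2 (\<phi> x) = g2 (\<phi> y) \<longleftrightarrow> \<phi> x = \<phi> y"
          using A(3) that by (intro inj_on_eq_iff[OF g2(1)]) auto
        then show "g2 (\<phi> x) = g2 (\<phi> y) \<longleftrightarrow> x = y" using A(2) that by (auto dest: inj_onD)
      qed
      have inj': "g2 (\<phi> y) \<noteq> g1 x" if "x \<in> IX" "y \<in> IX" for x y using inj(1)[OF that] by simp
      show ?thesis unfolding matching_def single_valued_def M using inj inj' by (auto simp: image_iff)
    qed
    ultimately show "M \<in> matches (pairs lab X Y)" by (simp add: matches_def)
  next
    fix M assume "M \<in> matches (pairs lab X Y)"
    then have M: "M \<subseteq> pairs lab X Y" and m: "matching M" by (auto simp: matches_def)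
    define IX where "IX = {x \<in> ?A. g1 x \<in> Domain M}"
    \<comment> \<open>The partner map read in abstract edges, restricted so as to be
      \<open>extensional\<close>, as \<open>gluings\<close> demands.\<close>
    define \<phi> where "\<phi> = restrict (\<lambda>x. inv_into ?B g2 (mate M (g1 x))) IX"
    have ph: "(g1 x, g2 (\<phi> x)) \<in> M \<and> \<phi> x \<in> ?B" if x: "x \<in> IX" for x
    proof -
      obtain y where y: "(g1 x, y) \<in> M" using x by (auto simp: IX_def)
      then have "mate M (g1 x) = y" "y \<in> g2 ` ?B" using mate_eq[OF m, of "g1 x" y] M g2(2) by (auto simp: pairs_def)
      then show ?thesis using x y by (auto simp: \<phi>_def f_inv_into_f inv_into_into)
    qed
    have "edge_pairs g1 g2 (IX, \<phi> ` IX, \<phi>) = M"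
    proof (intro equalityI subsetI)
      fix p assume p: "p \<in> M"
      then obtain x' y where xy: "p = (x', y)" "x' \<in> X" using M by (auto simp: pairs_def)
      then obtain x where x: "x \<in> ?A" "x' = g1 x" using g1(2) by blast
      then have xI: "x \<in> IX" using p xy by (auto simp: IX_def)
      have "y = g2 (\<phi> x)" using mate_eq[OF m, of "g1 x"] ph[OF xI] p xy x by auto
      then show "p \<in> edge_pairs g1 g2 (IX, \<phi> ` IX, \<phi>)" using xI xy x by (auto simp: edge_pairs_def)
    qed (use ph in \<open>auto simp: edge_pairs_def\<close>)
    moreover have "(IX, \<phi> ` IX, \<phi>) \<in> gluings P R"
    proof -
      have "inj_on \<phi> IX"
      proof (rule inj_onI)
        fix x x' assume x: "x \<in> IX" "x' \<in> IX" "\<phi> x = \<phi> x'"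
        then have "g1 x = g1 x'"
          using ph[of x] ph[of x'] mate_eq[OF m, of "g2 (\<phi> x)"] by (metis UnI2 converse_iff)
        then show "x = x'" using x g1(1) by (auto simp: IX_def dest: inj_onD)
      qed
      moreover have "pr (words R) (\<phi> x) = rev_edge (pr (words P) x)" if x: "x \<in> IX" for x
      proof -
        have "lab (g2 (\<phi> x)) = rev_edge (lab (g1 x))" using ph[OF x] M by (auto simp: pairs_def)
        then show ?thesis using l1[of x] l2[of "\<phi> x"] ph[OF x] x by (simp add: IX_def)
      qed
      moreover have "IX \<subseteq> ?A" "\<phi> \<in> extensional IX" by (auto simp: IX_def \<phi>_def)
      moreover have "\<phi> ` IX \<subseteq> ?B" using ph by blast
      ultimately show ?thesis by (simp add: gluings_def bij_betw_def)
    qed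
    ultimately show "M \<in> edge_pairs g1 g2 ` gluings P R" by (metis image_eqI)
  qed
qed

lemma weight_edge_pairs:
  assumes 1: "cyc_iso g1 (words P) X n lab" and 2: "cyc_iso g2 (words R) Y n lab"
    and g: "(IX, IY, \<phi>) \<in> gluings P R"
  shows "card (edge_pairs g1 g2 (IX, IY, \<phi>)) = card IX"
    and "weight Q lab (edge_pairs g1 g2 (IX, IY, \<phi>))
      = (-1) ^ card {y \<in> IY. pr (words R) y \<in> Orig ` arcs Q} / 2 ^ card IX"
proof -
  let ?f = "\<lambda>x. (g1 x, g2 (\<phi> x))"
  have IX: "IX \<subseteq> abs_edges (words P)" "inj_on \<phi> IX" "IY = \<phi> ` IX" "\<phi> ` IX \<subseteq> abs_edges (words R)"
    using g by (auto simp: gluings_def bij_betw_def)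
  have "inj_on g1 (abs_edges (words P))" using 1 by (auto simp: cyc_iso_def bij_betw_def)
  then have inj: "inj_on ?f IX" using IX(1) by (auto simp: inj_on_def subset_iff)
  then show c: "card (edge_pairs g1 g2 (IX, IY, \<phi>)) = card IX" by (simp add: edge_pairs_def card_image)
  let ?J = "{x \<in> IX. pr (words R) (\<phi> x) \<in> Orig ` arcs Q}"
  have l2: "lab (g2 (\<phi> x)) = pr (words R) (\<phi> x)" if "x \<in> IX" for x
    using 2 IX(4) that by (auto simp: cyc_iso_def)
  have "{p \<in> edge_pairs g1 g2 (IX, IY, \<phi>). lab (snd p) \<in> Orig ` arcs Q} = ?f ` ?J"
    using l2 unfolding edge_pairs_def by auto
  moreover have "{y \<in> IY. pr (words R) y \<in> Orig ` arcs Q} = \<phi> ` ?J" using IX(3) by auto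
  moreover have "card (?f ` ?J) = card ?J" "card (\<phi> ` ?J) = card ?J"
    using inj IX(2) by (auto intro!: card_image elim: inj_on_subset)
  ultimately show "weight Q lab (edge_pairs g1 g2 (IX, IY, \<phi>))
      = (-1) ^ card {y \<in> IY. pr (words R) y \<in> Orig ` arcs Q} / 2 ^ card IX"
    unfolding weight_def c by simp
qed

lemma cut_glue_edge_pairs:
  fixes P R :: "('v, 'e) collection"
  assumes 1: "cyc_iso g1 (words P) X n lab" and 2: "cyc_iso g2 (words R) Y n lab" and XY: "X \<inter> Y = {}"
    and V: "finite (X \<union> Y)" "bij_betw n (X \<union> Y) (X \<union> Y)" and w: "walks Q (X \<union> Y) n lab"
    and g: "(IX, IY, \<phi>) \<in> gluings P R" and M_def: "M = edge_pairs g1 g2 (IX, IY, \<phi>)"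
  shows "cut_glue Q P R IX IY \<phi> = coll Q (X \<union> Y) (n \<circ> mate M) lab (Field M) + (trivials P + trivials R)"
proof -
  let ?A = "abs_edges (words P)" and ?B = "abs_edges (words R)"
  let ?G = "case_sum g1 g2" and ?U = "abs_edges (words P) <+> abs_edges (words R)"
  let ?gp = "glue_perm (words P) (words R) IX IY \<phi>"
  have g1: "inj_on g1 ?A" "g1 ` ?A = X"
    and l1: "\<And>e. e \<in> ?A \<Longrightarrow> lab (g1 e) = pr (words P) e"
    and n1: "\<And>e. e \<in> ?A \<Longrightarrow> n (g1 e) = g1 (next_edge (words P) e)"
    using 1 by (auto simp: cyc_iso_def bij_betw_def)
  have g2: "inj_on g2 ?B" "g2 ` ?B = Y"
    and l2: "\<And>e. e \<in> ?B \<Longrightarrow> lab (g2 e) = pr (words R) e"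
    and n2: "\<And>e. e \<in> ?B \<Longrightarrow> n (g2 e) = g2 (next_edge (words R) e)"
    using 2 by (auto simp: cyc_iso_def bij_betw_def)
  have MM: "M \<in> matches (pairs lab X Y)"
    using bij_betw_edge_pairs[OF 1 2 XY] g unfolding M_def by (auto simp: bij_betw_def)
  then have m: "matching M" and lM: "labelled lab M" and FM: "Field M \<subseteq> X \<union> Y"
    by (auto simp: matches_def pairs_def labelled_def Field_def)
  have IX: "IX \<subseteq> ?A" "inj_on \<phi> IX" "IY = \<phi> ` IX" "IY \<subseteq> ?B" using g by (auto simp: gluings_def bij_betw_def)
  have M: "M = (\<lambda>x. (g1 x, g2 (\<phi> x))) ` IX" by (simp add: M_def edge_pairs_def)
  have G: "inj_on ?G ?U" "?G ` ?U = X \<union> Y"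
  proof -
    have ne: "g1 a \<noteq> g2 b" if "a \<in> ?A" "b \<in> ?B" for a b
    proof -
      have "g1 a \<in> X" "g2 b \<in> Y" using g1(2) g2(2) that by auto
      then show ?thesis using XY by auto
    qed
    show "inj_on ?G ?U"
    proof (rule inj_onI)
      fix u v assume uv: "u \<in> ?U" "v \<in> ?U" "?G u = ?G v"
      show "u = v"
      proof (cases u; cases v)
        fix a b assume "u = Inl a" "v = Inl b"
        then show ?thesis using uv inj_onD[OF g1(1), of a b] by auto
      next
        fix a b assume "u = Inl a" "v = Inr b"
        then show ?thesis using uv ne[of a b] by auto
      next
        fix a b assume "u = Inr a" "v = Inl b"
        then show ?thesis using uv ne[of b a] by auto
      next
        fix a b assume "u = Inr a" "v = Inr b"
        then show ?thesis using uv inj_onD[OF g2(1), of a b] by auto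
      qed
    qed
    show "?G ` ?U = X \<union> Y" using g1(2) g2(2) by (simp add: Plus_def image_Un image_image)
  qed
  have F: "Field M = ?G ` (IX <+> IY)"
    unfolding M IX(3) by (simp add: Plus_def image_Un image_image Field_def Domain_fst Range_snd)
  have inF: "?G u \<in> Field M \<longleftrightarrow> u \<in> IX <+> IY" if "u \<in> ?U" for u
    unfolding F using that IX(1,4) by (intro inj_on_image_mem_iff[OF G(1)]) auto
  have U: "glue_inv \<phi> IX u \<in> ?U \<and> mate M (?G u) = ?G (glue_inv \<phi> IX u)" if "u \<in> IX <+> IY" for u
  proof (cases u)
    case (Inl x)
    then have "x \<in> IX" using that by auto
    then show ?thesis using Inl IX mate_eq[OF m, of "g1 x" "g2 (\<phi> x)"] by (auto simp: glue_inv_def M)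
  next
    case (Inr y)
    then have "y \<in> \<phi> ` IX" using \<open>u \<in> IX <+> IY\<close> IX(3) by auto
    then obtain x where x: "x \<in> IX" "y = \<phi> x" by blast
    then show ?thesis using Inr IX mate_eq[OF m, of "g2 (\<phi> x)" "g1 x"] by (auto simp: glue_inv_def M)
  qed
  have nxt: "map_sum (next_edge (words P)) (next_edge (words R)) u \<in> ?U
      \<and> ?G (map_sum (next_edge (words P)) (next_edge (words R)) u) = n (?G u)" if "u \<in> ?U" for u
    using that n1 n2 by (auto simp: next_edge_in)
  have gp: "?gp u \<in> ?U \<and> ?G (?gp u) = n (mate M (?G u))" if u: "u \<in> ?U" for u
  proof (cases "u \<in> IX <+> IY")
    case True
    then show ?thesis using U[OF True] nxt[of "glue_inv \<phi> IX u"] by (simp add: glue_perm_def)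
  next
    case False
    then have "mate M (?G u) = ?G u" using inF[OF u] by (simp add: mate_outside)
    then show ?thesis using nxt[OF u] False by (simp add: glue_perm_def)
  qed
  \<comment> \<open>Transport goes from \<open>X \<union> Y\<close> to the abstract edges because
    \<open>coll_image\<close> wants bijectivity at the source, where it is known for
    \<open>n \<circ> mate M\<close>.\<close>
  let ?H = "inv_into ?U ?G"
  have H: "?H z \<in> ?U" "?G (?H z) = z" if "z \<in> X \<union> Y" for z
    using that G(2) by (metis inv_into_into, metis f_inv_into_f)
  have HU: "?H ` (X \<union> Y) = ?U" using G by (metis inv_into_image_cancel order_refl)
  have bij: "bij_betw (n \<circ> mate M) (X \<union> Y) (X \<union> Y)" using bij_betw_trans[OF bij_betw_mate[OF m FM] V(2)] .
  have "coll Q (?H ` (X \<union> Y)) ?gp (case_sum (pr (words P)) (pr (words R))) (IX <+> IY)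
      = coll Q (X \<union> Y) (n \<circ> mate M) lab (Field M)"
  proof (rule coll_image[OF V(1) bij])
    show "inj_on ?H (X \<union> Y)" using G(2) by (metis inj_on_inv_into order_refl)
    fix z assume z: "z \<in> X \<union> Y"
    have "?gp (?H z) \<in> ?U" "?G (?gp (?H z)) = (n \<circ> mate M) z" using gp[OF H(1)[OF z]] H(2)[OF z] by auto
    then show "?gp (?H z) = ?H ((n \<circ> mate M) z)" using inv_into_f_f[OF G(1)] by metis
    show "case_sum (pr (words P)) (pr (words R)) (?H z) = lab z"
    proof (cases "?H z")
      case (Inl a)
      then show ?thesis using H[OF z] l1[of a] by auto
    next
      case (Inr a)
      then show ?thesis using H[OF z] l2[of a] by auto
    qed
    show "?H z \<in> IX <+> IY \<longleftrightarrow> z \<in> Field M" using inF[OF H(1)[OF z]] H(2)[OF z] by simp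
  next
    fix z assume "z \<in> (X \<union> Y) \<inter> Field M"
    then show "tl_of Q (lab ((n \<circ> mate M) z)) = tl_of Q (lab z)" using tail_glued[OF m lM w FM] by simp
  qed
  then show ?thesis unfolding HU cut_glue_def Let_def coll_def by (simp add: add.assoc)
qed

text \<open>Any model isomorphic to the words of P and R may be used, so the choice made by
  \<open>words\<close> drops out. For a glued collection the model will be the return map.\<close>

lemma moyal_basis_matches:
  fixes P R :: "('v, 'e) collection"
  assumes 1: "cyc_iso g1 (words P) X n lab" and 2: "cyc_iso g2 (words R) Y n lab" and XY: "X \<inter> Y = {}"
    and V: "finite (X \<union> Y)" "bij_betw n (X \<union> Y) (X \<union> Y)" and w: "walks Q (X \<union> Y) n lab"
  shows "moyal_basis Q P R = (\<Sum>M \<in> matches (pairs lab X Y).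
    mterm Q lab (coll Q (X \<union> Y) (n \<circ> mate M) lab (Field M) + (trivials P + trivials R)) M)"
    (is "_ = (\<Sum>M \<in> _. ?t M)")
proof -
  have "(\<Sum>a \<in> gluings P R. ?t (edge_pairs g1 g2 a)) = (\<Sum>M \<in> matches (pairs lab X Y). ?t M)"
    by (rule sum.reindex_bij_betw[OF bij_betw_edge_pairs[OF 1 2 XY]])
  moreover have "moyal_basis Q P R = (\<Sum>a \<in> gluings P R. ?t (edge_pairs g1 g2 a))"
    unfolding moyal_basis_def
  proof (rule sum.cong[OF refl], clarify)
    fix IX IY \<phi> assume g: "(IX, IY, \<phi>) \<in> gluings P R"
    note w12 = weight_edge_pairs[OF 1 2 g]
    show "monom (Poly_Mapping.single (cut_glue Q P R IX IY \<phi>)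
              ((-1) ^ card {y \<in> IY. pr (words R) y \<in> Orig ` arcs Q} / 2 ^ card IX)) (card IX)
        = ?t (edge_pairs g1 g2 (IX, IY, \<phi>))"
      unfolding mterm_def cut_glue_edge_pairs[OF 1 2 XY V w g refl] w12 ..
  qed
  ultimately show ?thesis by simp
qed

section \<open>Gluing three collections\<close>

lemma finite_matches: "finite E \<Longrightarrow> finite (matches E)"
  by (rule finite_subset[of _ "Pow E"]) (auto simp: matches_def)

text \<open>A matching splits into its parts in E1 and E2, the second avoiding all edges used by the
  first. The assumption on \<open>E2\<inverse>\<close> excludes a pair together with its reversal,
  which \<open>matching\<close> alone would tolerate.\<close>

lemma sum_matches_split:
  assumes fin: "finite E1" "finite E2" and dis: "E1 \<inter> E2 = {}" "E1 \<inter> E2\<inverse> = {}"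
  shows "(\<Sum>M \<in> matches (E1 \<union> E2). f M) =
    (\<Sum>M1 \<in> matches E1. \<Sum>M2 \<in> matches {p \<in> E2. fst p \<notin> Field M1 \<and> snd p \<notin> Field M1}. f (M1 \<union> M2))"
proof -
  let ?E = "\<lambda>M1. {p \<in> E2. fst p \<notin> Field M1 \<and> snd p \<notin> Field M1}"
  have Fi: "M2 \<subseteq> ?E M1 \<longleftrightarrow> M2 \<subseteq> E2 \<and> Field M1 \<inter> Field M2 = {}" for M1 M2
    unfolding Field_def by fastforce
  have "(\<Sum>M1 \<in> matches E1. \<Sum>M2 \<in> matches (?E M1). f (M1 \<union> M2))
      = (\<Sum>(M1, M2) \<in> (SIGMA M1:matches E1. matches (?E M1)). f (M1 \<union> M2))"
    using fin by (intro sum.Sigma) (auto intro!: finite_matches)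
  also have "\<dots> = (\<Sum>M \<in> matches (E1 \<union> E2). f M)"
  proof (rule sum.reindex_bij_witness[where i = "\<lambda>M. (M \<inter> E1, M \<inter> E2)" and j = "\<lambda>(M1, M2). M1 \<union> M2"])
    fix a assume "a \<in> (SIGMA M1:matches E1. matches (?E M1))"
    then obtain M1 M2 where a: "a = (M1, M2)" "M1 \<subseteq> E1" "matching M1" "M2 \<subseteq> ?E M1" "matching M2"
      by (auto simp: matches_def)
    then have F: "M2 \<subseteq> E2" "Field M1 \<inter> Field M2 = {}" using Fi by auto
    show "((case a of (M1, M2) \<Rightarrow> M1 \<union> M2) \<inter> E1, (case a of (M1, M2) \<Rightarrow> M1 \<union> M2) \<inter> E2) = a"
      using a(1,2) F(1) dis by auto
    show "(case a of (M1, M2) \<Rightarrow> M1 \<union> M2) \<in> matches (E1 \<union> E2)"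
      using a F matching_Un[OF F(2)] by (auto simp: matches_def)
    show "f (case a of (M1, M2) \<Rightarrow> M1 \<union> M2) = (case a of (M1, M2) \<Rightarrow> f (M1 \<union> M2))" by (simp add: a(1))
  next
    fix M assume "M \<in> matches (E1 \<union> E2)"
    then have M: "M \<subseteq> E1 \<union> E2" "matching M" by (auto simp: matches_def)
    have u: "M \<inter> E1 \<union> M \<inter> E2 = M" using M(1) by auto
    then show "(case (M \<inter> E1, M \<inter> E2) of (M1, M2) \<Rightarrow> M1 \<union> M2) = M" by simp
    have F: "Field (M \<inter> E1) \<inter> Field (M \<inter> E2) = {}"
    proof (rule equals0I)
      fix z assume "z \<in> Field (M \<inter> E1) \<inter> Field (M \<inter> E2)"
      then obtain y y' where y: "(z, y) \<in> (M \<inter> E1) \<union> (M \<inter> E1)\<inverse>" and y': "(z, y') \<in> (M \<inter> E2) \<union> (M \<inter> E2)\<inverse>"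
        unfolding Field_def by blast
      then have "y = y'" using M(2) unfolding matching_def single_valued_def by blast
      then show False using y y' dis by blast
    qed
    then show "(M \<inter> E1, M \<inter> E2) \<in> (SIGMA M1:matches E1. matches (?E M1))"
      using matching_Un[OF F] M u Fi by (auto simp: matches_def)
  qed
  finally show ?thesis by simp
qed

lemma weight_Un:
  assumes "finite M1" "finite M2" "M1 \<inter> M2 = {}"
  shows "weight Q lab (M1 \<union> M2) = weight Q lab M1 * weight Q lab M2"
proof -
  have "{p \<in> M1 \<union> M2. lab (snd p) \<in> Orig ` arcs Q}
      = {p \<in> M1. lab (snd p) \<in> Orig ` arcs Q} \<union> {p \<in> M2. lab (snd p) \<in> Orig ` arcs Q}" by auto
  moreover have "card \<dots> = card {p \<in> M1. lab (snd p) \<in> Orig ` arcs Q} + card {p \<in> M2. lab (snd p) \<in> Orig ` arcs Q}"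
    using assms by (intro card_Un_disjoint) auto
  ultimately show ?thesis using assms by (simp add: weight_def card_Un_disjoint power_add)
qed

text \<open>The element c h^m of k[h], embedded through the empty collection.\<close>

definition scal :: "'k \<Rightarrow> nat \<Rightarrow> (('v, 'e) collection \<Rightarrow>\<^sub>0 'k::field_char_0) poly" where
  "scal c m = monom (Poly_Mapping.single 0 c) m"

lemma scal_mult_monom: "scal c m * monom (Poly_Mapping.single K d) n = monom (Poly_Mapping.single K (c * d)) (m + n)"
  by (simp add: scal_def mult_monom mult_single)

lemma scal_mult_scal: "scal c m * scal d n = scal (c * d) (m + n)"
  by (simp add: scal_def mult_monom mult_single)

lemma scal_mult_mterm:
  assumes "finite M1" "finite M2" "M1 \<inter> M2 = {}"
  shows "scal (weight Q lab M1) (card M1) * mterm Q lab K M2 = mterm Q lab K (M1 \<union> M2)"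
  using assms unfolding mterm_def scal_mult_monom by (simp add: weight_Un card_Un_disjoint)

text \<open>The glued collection is the left factor in one bracketing and the right factor in the
  other, hence two versions; they differ only in the orientation of the new pairs.\<close>

lemma glue_again:
  assumes fin: "finite B" "finite C" and BC: "B \<inter> C = {}" and n: "bij_betw n B B" "bij_betw n C C"
    and w: "walks Q (B \<union> C) n lab"
    and M1: "matching M1" "labelled lab M1" "Field M1 \<subseteq> B"
    and t: "\<And>N. N \<in># t \<Longrightarrow> \<exists>v. N = Triv v" and g: "cyc_iso g (words S) C n lab"
  defines "K \<equiv> coll Q B (n \<circ> mate M1) lab (Field M1) + t"
  shows "moyal_basis Q K S = (\<Sum>M2 \<in> matches (pairs lab (B - Field M1) C).
      mterm Q lab (coll Q (B \<union> C) (n \<circ> mate (M1 \<union> M2)) lab (Field (M1 \<union> M2)) + (t + trivials S)) M2)"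
    and "moyal_basis Q S K = (\<Sum>M2 \<in> matches (pairs lab C (B - Field M1)).
      mterm Q lab (coll Q (B \<union> C) (n \<circ> mate (M1 \<union> M2)) lab (Field (M1 \<union> M2)) + (t + trivials S)) M2)"
proof -
  let ?g = "n \<circ> mate M1" and ?D = "Field M1" and ?V = "B \<union> C"
  let ?r = "ret ?g ?D" and ?W = "B - Field M1"
  have nV: "bij_betw n ?V ?V" using n BC by (intro bij_betw_combine)
  have V: "finite ?V" using fin by simp
  have MV: "?D \<subseteq> ?V" using M1(3) by auto
  have gV: "bij_betw ?g ?V ?V" using bij_betw_trans[OF bij_betw_mate[OF M1(1) MV] nV] .
  have gB: "bij_betw ?g B B" using bij_betw_trans[OF bij_betw_mate[OF M1(1,3)] n(1)] .
  have tB: "tl_of Q (lab (?g z)) = tl_of Q (lab z)" if "z \<in> B \<inter> (?D \<union> {})" for z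
    using tail_glued[OF M1(1,2) w MV, of z] that by auto
  \<comment> \<open>With nothing cut afterwards, \<open>coll_ret\<close> exhibits K as the uncut
    cycles of the return map plus trivial paths.\<close>
  have "coll Q B ?g lab (?D \<union> {}) = coll Q ?W ?r lab {} + dead Q B ?g lab ?D"
    by (rule coll_ret[OF fin(1) gB]) (use tB in auto)
  then have K: "K = coll Q ?W ?r lab {} + (dead Q B ?g lab ?D + t)" by (simp add: K_def add.assoc)
  have W: "finite ?W" "bij_betw ?r ?W ?W" using fin(1) bij_betw_ret[OF fin(1) gB] by auto
  have T: "\<exists>v. N = Triv v" if "N \<in># dead Q B ?g lab ?D + t" for N
    using that t dead_Triv[OF _ fin(1) gB] by auto
  have trK: "trivials K = dead Q B ?g lab ?D + t" unfolding K by (rule collection_parts(1)[OF W T])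
  obtain h where h: "cyc_iso h (words K) ?W ?r lab" using collection_parts(2)[OF W T] unfolding K by blast
  \<comment> \<open>Edges of C are untouched by M1, so the return map serves as successor on both
    factors.\<close>
  have rC: "?r z = n z" if "z \<in> C" for z
  proof -
    have "n z \<in> C" using n(2) that by (auto simp: bij_betw_def)
    then have "z \<notin> ?D" "n z \<notin> ?D" using that M1(3) BC by auto
    then show ?thesis using ret_simp1[of ?g z ?D] by (simp add: mate_outside)
  qed
  have g': "cyc_iso g (words S) C ?r lab"
    using g rC by (auto simp: cyc_iso_def bij_betw_def)
  have WC: "?W \<union> C = ?V - ?D" "C \<union> ?W = ?V - ?D" using M1(3) BC by auto
  have rV: "bij_betw ?r (?V - ?D) (?V - ?D)" using bij_betw_ret[OF V gV] .
  have wr: "walks Q (?V - ?D) ?r lab" by (rule walks_ret[OF V nV M1(1,2) w MV])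
  have fr: "finite (?V - ?D)" using V by simp
  have dj: "?W \<inter> C = {}" "C \<inter> ?W = {}" using BC by auto
  have step: "coll Q (?V - ?D) (?r \<circ> mate M2) lab (Field M2) + (dead Q B ?g lab ?D + t + trivials S)
      = coll Q ?V (n \<circ> mate (M1 \<union> M2)) lab (Field (M1 \<union> M2)) + (t + trivials S)"
    if M2: "M2 \<in> matches (pairs lab ?W C) \<or> M2 \<in> matches (pairs lab C ?W)" for M2
  proof -
    have m2: "matching M2" "labelled lab M2" "Field M2 \<subseteq> ?V - ?D"
      using M2 BC M1(3) by (auto simp: matches_def pairs_def labelled_def Field_def)
    then have dis: "?D \<inter> Field M2 = {}" by auto
    have F2: "Field M2 \<subseteq> ?V" using m2(3) by auto
    have m: "matching (M1 \<union> M2)" using matching_Un[OF dis] M1(1) m2(1) by simp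
    have l: "labelled lab (M1 \<union> M2)" using M1(2) m2(2) by (auto simp: labelled_def)
    have "coll Q ?V (n \<circ> mate (M1 \<union> M2)) lab (Field (M1 \<union> M2))
        = coll Q (?V - ?D) (?r \<circ> mate M2) lab (Field M2) + dead Q B ?g lab ?D"
      by (rule coll_glue_twice[OF V nV Un_upper1 n(1) M1(3) F2 dis m l w])
    then show ?thesis by (simp add: add_ac)
  qed
  show "moyal_basis Q K S = (\<Sum>M2 \<in> matches (pairs lab ?W C).
      mterm Q lab (coll Q ?V (n \<circ> mate (M1 \<union> M2)) lab (Field (M1 \<union> M2)) + (t + trivials S)) M2)"
    using moyal_basis_matches[OF h g' dj(1), unfolded WC, OF fr rV wr] step
    by (simp add: trK cong: sum.cong)
  show "moyal_basis Q S K = (\<Sum>M2 \<in> matches (pairs lab C ?W).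
      mterm Q lab (coll Q ?V (n \<circ> mate (M1 \<union> M2)) lab (Field (M1 \<union> M2)) + (t + trivials S)) M2)"
    using moyal_basis_matches[OF g' h dj(2), unfolded WC, OF fr rV wr] step
    by (simp add: trK add_ac cong: sum.cong)
qed

definition glued :: "('v, 'e) pre_digraph \<Rightarrow> 'z set \<Rightarrow> ('z \<Rightarrow> 'z) \<Rightarrow> ('z \<Rightarrow> 'e dedge) \<Rightarrow> ('v, 'e) collection \<Rightarrow>
    ('z \<times> 'z) set \<Rightarrow> ('v, 'e) collection" where
  "glued Q V n lab t M = coll Q V (n \<circ> mate M) lab (Field M) + t"

text \<open>The second product contributes only the weight of M2; the factor
  \<open>scal (weight Q lab M) (card M)\<close> comes from the first product. As the two matchings
  are disjoint, both combine to the weight and the power of h of their union.\<close>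

lemma triple_sum:
  fixes P R S :: "('v, 'e) collection"
  assumes iso: "cyc_iso g1 (words P) X n lab" "cyc_iso g2 (words R) Y n lab" "cyc_iso g3 (words S) Z n lab"
    and fin: "finite X" "finite Y" "finite Z" and dis: "X \<inter> Y = {}" "X \<inter> Z = {}" "Y \<inter> Z = {}"
    and n: "bij_betw n X X" "bij_betw n Y Y" "bij_betw n Z Z" and w: "walks Q (X \<union> Y \<union> Z) n lab"
  shows "(\<Sum>M \<in> matches (pairs lab X Y). scal (weight Q lab M) (card M) *
        moyal_basis Q (glued Q (X \<union> Y) n lab (trivials P + trivials R) M) S)
      = (\<Sum>M \<in> matches (pairs lab Y Z). scal (weight Q lab M) (card M) *
        (moyal_basis Q P (glued Q (Y \<union> Z) n lab (trivials R + trivials S) M)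
          :: (('v, 'e) collection \<Rightarrow>\<^sub>0 'k::field_char_0) poly))"
proof -
  let ?V = "X \<union> Y \<union> Z" and ?t = "trivials P + trivials R + trivials S"
  let ?f = "\<lambda>M. mterm Q lab (glued Q ?V n lab ?t M) M :: (('v, 'e) collection \<Rightarrow>\<^sub>0 'k) poly"
  have fp: "finite (pairs lab A B)" if "finite A" "finite B" for A B
    by (rule finite_subset[of _ "A \<times> B"]) (use that in \<open>auto simp: pairs_def\<close>)
  have tr: "\<exists>v. N = Triv v" if "N \<in># trivials A + trivials B" for N and A B :: "('v, 'e) collection"
    using that by (auto simp: trivials_def)
  have props: "matching M" "labelled lab M" "Field M \<subseteq> A \<union> B" "finite M"
    if "M \<in> matches (pairs lab A B)" "finite A" "finite B" for M A B
    using that finite_subset[OF _ fp[OF that(2,3)]] by (auto simp: matches_def pairs_def labelled_def Field_def)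
  have XY: "finite (X \<union> Y)" "(X \<union> Y) \<inter> Z = {}" "bij_betw n (X \<union> Y) (X \<union> Y)"
    using fin dis n bij_betw_combine[of n X X Y Y] by auto
  have YZ: "finite (Y \<union> Z)" "(Y \<union> Z) \<inter> X = {}" "bij_betw n (Y \<union> Z) (Y \<union> Z)"
    using fin dis n bij_betw_combine[of n Y Y Z Z] by auto
  have left: "scal (weight Q lab M1) (card M1) * moyal_basis Q (glued Q (X \<union> Y) n lab (trivials P + trivials R) M1) S
      = (\<Sum>M2 \<in> matches {p \<in> pairs lab (X \<union> Y) Z. fst p \<notin> Field M1 \<and> snd p \<notin> Field M1}. ?f (M1 \<union> M2))"
    if M1: "M1 \<in> matches (pairs lab X Y)" for M1
  proof -
    note p = props[OF M1 fin(1,2)]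
    \<comment> \<open>M1 does not touch Z, so discarding the pairs that meet M1 leaves the pairs
      between surviving edges and Z.\<close>
    have E: "{p \<in> pairs lab (X \<union> Y) Z. fst p \<notin> Field M1 \<and> snd p \<notin> Field M1} = pairs lab (X \<union> Y - Field M1) Z"
      using p(3) XY(2) by (auto simp: pairs_def)
    have 1: "moyal_basis Q (glued Q (X \<union> Y) n lab (trivials P + trivials R) M1) S
      = (\<Sum>M2 \<in> matches (pairs lab (X \<union> Y - Field M1) Z). mterm Q lab (glued Q ?V n lab ?t (M1 \<union> M2)) M2)"
      unfolding glued_def by (rule glue_again(1)[OF XY(1) fin(3) XY(2,3) n(3) w p(1-3) tr[of _ P R] iso(3)])
    show ?thesis
      unfolding E 1 sum_distrib_left
    proof (rule sum.cong[OF refl], rule scal_mult_mterm)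
      fix M2 assume M2: "M2 \<in> matches (pairs lab (X \<union> Y - Field M1) Z)"
      show "finite M1" by (rule p(4))
      show "finite M2" using M2 XY(1) fin(3) by (intro props(4)[OF M2]) auto
      show "M1 \<inter> M2 = {}" using M2 by (auto simp: matches_def pairs_def Field_def)
    qed
  qed
  have right: "scal (weight Q lab M1) (card M1) * moyal_basis Q P (glued Q (Y \<union> Z) n lab (trivials R + trivials S) M1)
      = (\<Sum>M2 \<in> matches {p \<in> pairs lab X (Y \<union> Z). fst p \<notin> Field M1 \<and> snd p \<notin> Field M1}. ?f (M1 \<union> M2))"
    if M1: "M1 \<in> matches (pairs lab Y Z)" for M1
  proof -
    note p = props[OF M1 fin(2,3)]
    have V: "Y \<union> Z \<union> X = ?V" "trivials R + trivials S + trivials P = ?t" by (auto simp: add_ac)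
    have E: "{p \<in> pairs lab X (Y \<union> Z). fst p \<notin> Field M1 \<and> snd p \<notin> Field M1} = pairs lab X (Y \<union> Z - Field M1)"
      using p(3) YZ(2) by (auto simp: pairs_def)
    have w': "walks Q (Y \<union> Z \<union> X) n lab" using w V by simp
    have 1: "moyal_basis Q P (glued Q (Y \<union> Z) n lab (trivials R + trivials S) M1)
      = (\<Sum>M2 \<in> matches (pairs lab X (Y \<union> Z - Field M1)). mterm Q lab (glued Q ?V n lab ?t (M1 \<union> M2)) M2)"
      unfolding glued_def
      unfolding V(1,2)[symmetric]
      by (rule glue_again(2)[OF YZ(1) fin(1) YZ(2,3) n(1) w' p(1-3) tr[of _ R S] iso(1)])
    show ?thesis
      unfolding E 1 sum_distrib_left
    proof (rule sum.cong[OF refl], rule scal_mult_mterm)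
      fix M2 assume M2: "M2 \<in> matches (pairs lab X (Y \<union> Z - Field M1))"
      show "finite M1" by (rule p(4))
      show "finite M2" using M2 YZ(1) fin(1) by (intro props(4)[OF M2]) auto
      show "M1 \<inter> M2 = {}" using M2 by (auto simp: matches_def pairs_def Field_def)
    qed
  qed
  \<comment> \<open>Associativity comes down to this equality of sets of ordered pairs: in both
    bracketings a pair points from the earlier to the later of X, Y, Z, so the signs agree.\<close>
  have E: "pairs lab X Y \<union> pairs lab (X \<union> Y) Z = pairs lab Y Z \<union> pairs lab X (Y \<union> Z)"
    by (auto simp: pairs_def)
  have "(\<Sum>M \<in> matches (pairs lab X Y \<union> pairs lab (X \<union> Y) Z). ?f M) =
    (\<Sum>M1 \<in> matches (pairs lab X Y).
      \<Sum>M2 \<in> matches {p \<in> pairs lab (X \<union> Y) Z. fst p \<notin> Field M1 \<and> snd p \<notin> Field M1}. ?f (M1 \<union> M2))"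
    using fin dis by (intro sum_matches_split fp) (auto simp: pairs_def)
  moreover have "(\<Sum>M \<in> matches (pairs lab Y Z \<union> pairs lab X (Y \<union> Z)). ?f M) =
    (\<Sum>M1 \<in> matches (pairs lab Y Z).
      \<Sum>M2 \<in> matches {p \<in> pairs lab X (Y \<union> Z). fst p \<notin> Field M1 \<and> snd p \<notin> Field M1}. ?f (M1 \<union> M2))"
    using fin dis by (intro sum_matches_split fp) (auto simp: pairs_def)
  ultimately show ?thesis unfolding E by (simp add: left right cong: sum.cong)
qed

section \<open>Closed walks and the cyclic successor on abstract edges\<close>

lemma cas_tail_head:
  "pre_digraph.cas G u w v \<Longrightarrow> map (tail G) w @ [v] = u # map (head G) w"
  by (induction w arbitrary: u) (auto simp: pre_digraph.cas.simps)

lemma closed_walk_cyclic: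
  assumes "w \<noteq> []" "pre_digraph.cas G v w v"
  shows "map (tail G) (rotate1 w) = map (head G) w"
  using cas_tail_head[OF assms(2)] assms(1) by (cases w) auto

text \<open>The chosen word is a rotation of a closed walk, and the equation between the tails of
  \<open>rotate1\<close> of a word and its heads is invariant under rotation.\<close>

lemma words_closed:
  assumes P: "set_mset P \<subseteq> necklaces Q" and e: "e \<in> abs_edges (words P)"
  shows "tail (double Q) (pr (words P) (next_edge (words P) e)) = head (double Q) (pr (words P) e)"
proof -
  let ?t = "tail (double Q)" and ?h = "head (double Q)"
  obtain i j where ij: "e = (i, j)" "i < length (words P)" "j < length (words P ! i)"
    using e by (auto simp: abs_edges_def)
  let ?w = "words P ! i"
  have "Cyc (abs_cyclic_word ?w) \<in># filter_mset (\<lambda>N. \<nexists>v. N = Triv v) P"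
    unfolding mset_words[symmetric] using ij(2) by auto
  then have "Cyc (abs_cyclic_word ?w) \<in> necklaces Q" using P by auto
  then obtain w v where w: "abs_cyclic_word ?w = abs_cyclic_word w" "w \<noteq> []" "pre_digraph.awalk (double Q) v w v"
    by (auto simp: necklaces_def)
  then obtain k where k: "?w = rotate k w" by (metis cyclic_word.abs_eq_iff)
  have "map ?t (rotate1 w) = map ?h w"
    using closed_walk_cyclic w(2,3) by (auto simp: pre_digraph.awalk_def)
  then have "map ?t (rotate1 ?w) = map ?h ?w"
    unfolding k by (simp add: rotate1_rotate_swap rotate_map[symmetric])
  then have "map ?t (rotate1 ?w) ! j = map ?h ?w ! j" by simp
  then show ?thesis using ij by (simp add: pr_def next_edge_def nth_rotate1)
qed

lemma bij_betw_next_edge: "bij_betw (next_edge ws) (abs_edges ws) (abs_edges ws)"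
proof -
  have im: "next_edge ws ` abs_edges ws = abs_edges ws"
  proof (intro equalityI subsetI)
    fix e assume "e \<in> abs_edges ws"
    then obtain i j where ij: "e = (i, j)" "i < length ws" "j < length (ws ! i)" by (auto simp: abs_edges_def)
    let ?l = "length (ws ! i)"
    \<comment> \<open>The preimage has index j - 1 modulo the length, written
      \<open>j + (?l - 1)\<close> to stay in the naturals.\<close>
    have "Suc ((j + (?l - 1)) mod ?l) mod ?l = Suc (j + (?l - 1)) mod ?l" by (rule mod_Suc_eq)
    also have "Suc (j + (?l - 1)) = j + ?l" using ij(3) by simp
    also have "(j + ?l) mod ?l = j" using ij(3) by simp
    finally have "next_edge ws (i, (j + (?l - 1)) mod ?l) = e" by (simp add: next_edge_def ij(1))
    moreover have "(i, (j + (?l - 1)) mod ?l) \<in> abs_edges ws"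
      using ij by (auto simp: abs_edges_def intro!: mod_less_divisor)
    ultimately show "e \<in> next_edge ws ` abs_edges ws" by (metis image_eqI)
  qed (auto simp: next_edge_in)
  moreover from this have "inj_on (next_edge ws) (abs_edges ws)"
    by (intro finite_surj_inj finite_abs_edges) simp
  ultimately show ?thesis by (simp add: bij_betw_def)
qed

section \<open>Bilinearity\<close>

definition supp :: "(('v, 'e) collection \<Rightarrow>\<^sub>0 'k::field_char_0) poly \<Rightarrow> ('v, 'e) collection set" where
  "supp p = (\<Union>m. Poly_Mapping.keys (coeff p m))"

lemma keys_subset_supp: "Poly_Mapping.keys (coeff p m) \<subseteq> supp p"
  by (auto simp: supp_def)

lemma finite_supp: "finite (supp p)"
proof -
  have "supp p \<subseteq> (\<Union>m\<le>degree p. Poly_Mapping.keys (coeff p m))"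
  proof
    fix K assume "K \<in> supp p"
    then obtain m where m: "K \<in> Poly_Mapping.keys (coeff p m)" by (auto simp: supp_def)
    then have "m \<le> degree p" by (intro le_degree) auto
    then show "K \<in> (\<Union>m\<le>degree p. Poly_Mapping.keys (coeff p m))" using m by blast
  qed
  then show ?thesis by (rule finite_subset) simp
qed

definition coef :: "(('v, 'e) collection \<Rightarrow>\<^sub>0 'k::field_char_0) poly \<Rightarrow> nat \<Rightarrow> ('v, 'e) collection \<Rightarrow> 'k" where
  "coef p m K = Poly_Mapping.lookup (coeff p m) K"

lemma coef_add: "coef (p + q) m K = coef p m K + coef q m K"
  by (simp add: coef_def lookup_add)

lemma coef_eq_0: "K \<notin> Poly_Mapping.keys (coeff p m) \<Longrightarrow> coef p m K = 0"
  by (simp add: coef_def in_keys_iff)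

lemma coef_degree: "degree p < m \<Longrightarrow> coef p m K = 0"
  by (simp add: coef_def coeff_eq_0)

lemma scal_0 [simp]: "scal 0 m = 0"
  by (simp add: scal_def)

lemma scal_add: "scal (c + d) m = scal c m + scal d m"
  by (simp add: scal_def single_add add_monom)

text \<open>\<open>moyal\<close> sums over degrees and supports of its arguments, which change under
  addition. Terms added by larger ranges vanish, so p, q and p + q can be expanded over common
  indices.\<close>

lemma moyal_eq:
  assumes "degree p \<le> a" "degree r \<le> b" "finite A" "supp p \<subseteq> A" "finite B" "supp r \<subseteq> B"
  shows "moyal Q p r = (\<Sum>m\<le>a. \<Sum>n\<le>b. \<Sum>P\<in>A. \<Sum>R\<in>B. scal (coef p m P * coef r n R) (m + n) * moyal_basis Q P R)"
proof -
  let ?T = "\<lambda>m n P R. scal (coef p m P * coef r n R) (m + n) * moyal_basis Q P R"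
  have A: "Poly_Mapping.keys (coeff p m) \<subseteq> A" for m using keys_subset_supp assms(4) by (rule subset_trans)
  have B: "Poly_Mapping.keys (coeff r n) \<subseteq> B" for n using keys_subset_supp assms(6) by (rule subset_trans)
  have 1: "(\<Sum>R\<in>Poly_Mapping.keys (coeff r n). ?T m n P R) = (\<Sum>R\<in>B. ?T m n P R)" for m n P
    by (rule sum.mono_neutral_left[OF assms(5) B]) (auto simp: coef_eq_0)
  have 2: "(\<Sum>P\<in>Poly_Mapping.keys (coeff p m). \<Sum>R\<in>B. ?T m n P R) = (\<Sum>P\<in>A. \<Sum>R\<in>B. ?T m n P R)" for m n
    by (rule sum.mono_neutral_left[OF assms(3) A]) (auto simp: coef_eq_0)
  have 3: "(\<Sum>n\<le>degree r. \<Sum>P\<in>A. \<Sum>R\<in>B. ?T m n P R) = (\<Sum>n\<le>b. \<Sum>P\<in>A. \<Sum>R\<in>B. ?T m n P R)" for m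
    by (rule sum.mono_neutral_left) (use assms(2) in \<open>auto simp: coef_degree\<close>)
  have 4: "(\<Sum>m\<le>degree p. \<Sum>n\<le>b. \<Sum>P\<in>A. \<Sum>R\<in>B. ?T m n P R) = (\<Sum>m\<le>a. \<Sum>n\<le>b. \<Sum>P\<in>A. \<Sum>R\<in>B. ?T m n P R)"
    by (rule sum.mono_neutral_left) (use assms(1) in \<open>auto simp: coef_degree\<close>)
  show ?thesis
    unfolding moyal_def coef_def[symmetric] scal_def[symmetric] 1 2 3 4 ..
qed

lemma supp_add: "supp (p + q) \<subseteq> supp p \<union> supp q"
  using keys_add by (fastforce simp: supp_def)

lemma moyal_add_left: "moyal Q (p + q) r = moyal Q p r + moyal Q q r"
proof -
  let ?a = "max (degree p) (degree q)" and ?A = "supp p \<union> supp q"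
  note eq = moyal_eq[of _ ?a r "degree r" ?A "supp r" Q]
  have "moyal Q (p + q) r = (\<Sum>m\<le>?a. \<Sum>n\<le>degree r. \<Sum>P\<in>?A. \<Sum>R\<in>supp r.
      scal (coef (p + q) m P * coef r n R) (m + n) * moyal_basis Q P R)"
    by (intro eq degree_add_le_max supp_add) (auto simp: finite_supp)
  also have "\<dots> = (\<Sum>m\<le>?a. \<Sum>n\<le>degree r. \<Sum>P\<in>?A. \<Sum>R\<in>supp r. scal (coef p m P * coef r n R) (m + n) * moyal_basis Q P R)
      + (\<Sum>m\<le>?a. \<Sum>n\<le>degree r. \<Sum>P\<in>?A. \<Sum>R\<in>supp r. scal (coef q m P * coef r n R) (m + n) * moyal_basis Q P R)"
    by (simp add: coef_add scal_add distrib_right sum.distrib)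
  also have "\<dots> = moyal Q p r + moyal Q q r"
    by (subst (1 2) eq) (auto simp: finite_supp)
  finally show ?thesis .
qed

lemma moyal_add_right: "moyal Q r (p + q) = moyal Q r p + moyal Q r q"
proof -
  let ?a = "max (degree p) (degree q)" and ?A = "supp p \<union> supp q"
  note eq = moyal_eq[of r "degree r" _ ?a "supp r" ?A Q]
  have "moyal Q r (p + q) = (\<Sum>n\<le>degree r. \<Sum>m\<le>?a. \<Sum>R\<in>supp r. \<Sum>P\<in>?A.
      scal (coef r n R * coef (p + q) m P) (n + m) * moyal_basis Q R P)"
    by (intro eq degree_add_le_max supp_add) (auto simp: finite_supp)
  also have "\<dots> = (\<Sum>n\<le>degree r. \<Sum>m\<le>?a. \<Sum>R\<in>supp r. \<Sum>P\<in>?A. scal (coef r n R * coef p m P) (n + m) * moyal_basis Q R P)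
      + (\<Sum>n\<le>degree r. \<Sum>m\<le>?a. \<Sum>R\<in>supp r. \<Sum>P\<in>?A. scal (coef r n R * coef q m P) (n + m) * moyal_basis Q R P)"
    by (simp add: coef_add scal_add distrib_right distrib_left sum.distrib)
  also have "\<dots> = moyal Q r p + moyal Q r q"
    by (subst (1 2) eq) (auto simp: finite_supp)
  finally show ?thesis .
qed

lemma moyal_0_left [simp]: "moyal Q 0 r = 0"
  by (simp add: moyal_def)

lemma moyal_0_right [simp]: "moyal Q r 0 = 0"
  by (simp add: moyal_def)

lemma moyal_sum_left: "moyal Q (\<Sum>i\<in>I. p i) r = (\<Sum>i\<in>I. moyal Q (p i) r)"
  by (induction I rule: infinite_finite_induct) (auto simp: moyal_add_left)

lemma moyal_sum_right: "moyal Q r (\<Sum>i\<in>I. p i) = (\<Sum>i\<in>I. moyal Q r (p i))"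
  by (induction I rule: infinite_finite_induct) (auto simp: moyal_add_right)

abbreviation bas :: "('v, 'e) collection \<Rightarrow> 'k \<Rightarrow> nat \<Rightarrow> (('v, 'e) collection \<Rightarrow>\<^sub>0 'k::field_char_0) poly" where
  "bas K c m \<equiv> monom (Poly_Mapping.single K c) m"

lemma coef_bas: "coef (bas K c m) i L = (if i = m \<and> L = K then c else 0)"
  by (auto simp: coef_def lookup_single when_def)

lemma supp_bas: "supp (bas K c m) \<subseteq> {K}"
  by (auto simp: supp_def split: if_splits)

lemma moyal_bas: "moyal Q (bas K c m) (bas L d n) = scal (c * d) (m + n) * moyal_basis Q K L"
proof -
  have "moyal Q (bas K c m) (bas L d n) = (\<Sum>i\<le>m. \<Sum>j\<le>n. \<Sum>P\<in>{K}. \<Sum>R\<in>{L}.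
      scal (coef (bas K c m) i P * coef (bas L d n) j R) (i + j) * moyal_basis Q P R)"
    by (rule moyal_eq) (auto intro!: degree_monom_le dest: subsetD[OF supp_bas])
  also have "\<dots> = (\<Sum>i\<le>m. \<Sum>j\<le>n. if j = n then (if i = m then scal (c * d) (m + n) * moyal_basis Q K L else 0) else 0)"
    by (intro sum.cong refl) (simp add: coef_bas)
  finally show ?thesis by simp
qed

lemma bas_decomposition:
  "p = (\<Sum>m\<le>degree p. \<Sum>K\<in>Poly_Mapping.keys (coeff p m). bas K (coef p m K) m)"
proof -
  have eq: "coeff p m = (\<Sum>K\<in>Poly_Mapping.keys (coeff p m). Poly_Mapping.single K (coef p m K))" for m
    by (rule poly_mapping_eqI) (auto simp: lookup_sum lookup_single when_def coef_def in_keys_iff)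
  have "monom (coeff p m) m = (\<Sum>K\<in>Poly_Mapping.keys (coeff p m). bas K (coef p m K) m)" for m
    by (rule trans[OF arg_cong[OF eq, of "\<lambda>a. monom a m"] monom_sum])
  then have "(\<Sum>m\<le>degree p. monom (coeff p m) m)
      = (\<Sum>m\<le>degree p. \<Sum>K\<in>Poly_Mapping.keys (coeff p m). bas K (coef p m K) m)"
    by (intro sum.cong refl)
  then show ?thesis by (simp only: poly_as_sum_of_monoms)
qed

lemma moyal_scal_left: "moyal Q (scal c m * p) r = scal c m * moyal Q p r"
proof -
  have bas: "moyal Q (scal c m * bas K d i) (bas L e j) = scal c m * moyal Q (bas K d i) (bas L e j)" for K d i L e j
    unfolding scal_mult_monom moyal_bas mult.assoc[symmetric] scal_mult_scal by (simp add: ac_simps)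
  have "moyal Q (scal c m * bas K d i) r = scal c m * moyal Q (bas K d i) r" for K d i
    by (subst (1 2) bas_decomposition[of r]) (simp add: moyal_sum_right sum_distrib_left bas)
  then show ?thesis
    by (subst (1 2) bas_decomposition[of p]) (simp add: moyal_sum_left sum_distrib_left)
qed

lemma moyal_scal_right: "moyal Q r (scal c m * p) = scal c m * moyal Q r p"
proof -
  have bas: "moyal Q (bas L e j) (scal c m * bas K d i) = scal c m * moyal Q (bas L e j) (bas K d i)" for K d i L e j
    unfolding scal_mult_monom moyal_bas mult.assoc[symmetric] scal_mult_scal by (simp add: ac_simps)
  have "moyal Q (bas L e j) (scal c m * p) = scal c m * moyal Q (bas L e j) p" for L e j
    by (subst (1 2) bas_decomposition[of p]) (simp add: moyal_sum_right sum_distrib_left bas)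
  then show ?thesis
    by (subst (1 2) bas_decomposition[of r]) (simp add: moyal_sum_left sum_distrib_left)
qed

text \<open>The basis case offers only collections of necklaces of Q, so that the closed-walk
  property is available there.\<close>

lemma SymL_h_induct [consumes 1, case_names basis zero add]:
  assumes "p \<in> SymL_h Q"
    and basis: "\<And>K c m. set_mset K \<subseteq> necklaces Q \<Longrightarrow> C (bas K c m)"
    and zero: "C 0" and add: "\<And>p q. C p \<Longrightarrow> C q \<Longrightarrow> C (p + q)"
  shows "C p"
proof -
  have sum: "C (\<Sum>i\<in>I. q i)" if "\<And>i. i \<in> I \<Longrightarrow> C (q i)" for I :: "'x set" and q
    using that by (induction I rule: infinite_finite_induct) (auto simp: zero add)
  have "C (\<Sum>m\<le>degree p. \<Sum>K\<in>Poly_Mapping.keys (coeff p m). bas K (coef p m K) m)"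
    using assms(1) by (intro sum basis) (auto simp: SymL_h_def SymL_def)
  then show ?thesis using bas_decomposition[of p] by simp
qed

section \<open>Associativity\<close>

lemma mterm_bas: "mterm Q lab K M = bas K (weight Q lab M) (card M)"
  by (rule mterm_def)

lemma moyal_assoc_basis:
  fixes P R S :: "('v, 'e) collection" and c d e :: "'k::field_char_0"
  assumes "set_mset P \<subseteq> necklaces Q" "set_mset R \<subseteq> necklaces Q" "set_mset S \<subseteq> necklaces Q"
  shows "moyal Q (moyal Q (bas P c i) (bas R d j)) (bas S e k) = moyal Q (bas P c i) (moyal Q (bas R d j) (bas S e k))"
proof -
  \<comment> \<open>Tags 0, 1, 2 make the three sets of abstract edges disjoint within one type,
    even for equal collections; \<open>E 0\<close>, \<open>E 1\<close>, \<open>E 2\<close> play the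
    roles of X, Y, Z.\<close>
  define U where "U = (\<lambda>a::nat. if a = 0 then P else if a = 1 then R else S)"
  define n where "n = (\<lambda>(a, x). (a, next_edge (words (U a)) x))"
  define lab where "lab = (\<lambda>(a, x). pr (words (U a)) x)"
  define E where "E = (\<lambda>a. Pair a ` abs_edges (words (U a)))"
  have n_simp: "n (a, x) = (a, next_edge (words (U a)) x)" for a x by (simp add: n_def)
  have iso: "cyc_iso (Pair a) (words (U a)) (E a) n lab" for a
    by (auto simp: cyc_iso_def E_def n_def lab_def bij_betw_def inj_on_def)
  have fin: "finite (E a)" for a by (simp add: E_def finite_abs_edges)
  have dis: "E a \<inter> E b = {}" if "a \<noteq> b" for a b using that by (auto simp: E_def)
  have n: "bij_betw n (E a) (E a)" for a
  proof -
    have "inj_on n (E a)"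
      using bij_betw_next_edge[of "words (U a)"] by (auto simp: bij_betw_def inj_on_def E_def n_simp)
    moreover have "n ` E a = E a"
    proof -
      have "n ` E a = Pair a ` next_edge (words (U a)) ` abs_edges (words (U a))"
        by (simp add: E_def image_image n_simp)
      then show ?thesis using bij_betw_next_edge[of "words (U a)"] by (simp add: bij_betw_def E_def)
    qed
    ultimately show ?thesis by (simp add: bij_betw_def)
  qed
  have U_necklaces: "set_mset (U a) \<subseteq> necklaces Q" for a using assms by (simp add: U_def)
  have w: "walks Q (E 0 \<union> E 1 \<union> E 2) n lab"
    by (auto simp: walks_def E_def n_def lab_def words_closed[OF U_necklaces])
  have U: "U 0 = P" "U 1 = R" "U 2 = S" by (auto simp: U_def)
  note iso3 = iso[of 0, unfolded U] iso[of 1, unfolded U] iso[of 2, unfolded U]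
  have d3: "E 0 \<inter> E 1 = {}" "E 0 \<inter> E 2 = {}" "E 1 \<inter> E 2 = {}" by (rule dis, simp)+
  let ?l = "\<lambda>M. moyal_basis Q (glued Q (E 0 \<union> E 1) n lab (trivials P + trivials R) M) S"
  let ?r = "\<lambda>M. moyal_basis Q P (glued Q (E 1 \<union> E 2) n lab (trivials R + trivials S) M)"
  have "moyal_basis Q P R = (\<Sum>M \<in> matches (pairs lab (E 0) (E 1)).
      bas (glued Q (E 0 \<union> E 1) n lab (trivials P + trivials R) M) (weight Q lab M :: 'k) (card M))"
    unfolding glued_def mterm_bas[symmetric]
  proof (rule moyal_basis_matches[OF iso3(1,2) d3(1)])
    show "finite (E 0 \<union> E 1)" using fin by simp
    show "bij_betw n (E 0 \<union> E 1) (E 0 \<union> E 1)" by (rule bij_betw_combine[OF n n d3(1)])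
    show "walks Q (E 0 \<union> E 1) n lab" using w by (auto simp: walks_def)
  qed
  then have "moyal Q (moyal Q (bas P c i) (bas R d j)) (bas S e k)
      = scal (c * d) (i + j) * (\<Sum>M \<in> matches (pairs lab (E 0) (E 1)). scal (weight Q lab M * e) (card M + k) * ?l M)"
    by (simp add: moyal_bas moyal_scal_left moyal_sum_left)
  \<comment> \<open>All coefficients are collected in front, so that the remaining sum is literally
    one side of \<open>triple_sum\<close>.\<close>
  also have "\<dots> = scal (c * d * e) (i + j + k) * (\<Sum>M \<in> matches (pairs lab (E 0) (E 1)). scal (weight Q lab M) (card M) * ?l M)"
    unfolding sum_distrib_left mult.assoc[symmetric] scal_mult_scal by (simp add: ac_simps)
  also have "\<dots> = scal (c * d * e) (i + j + k) * (\<Sum>M \<in> matches (pairs lab (E 1) (E 2)). scal (weight Q lab M) (card M) * ?r M)"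
    by (rule arg_cong[OF triple_sum[OF iso3 fin fin fin d3 n n n w]])
  also have "\<dots> = scal (d * e) (j + k) * (\<Sum>M \<in> matches (pairs lab (E 1) (E 2)). scal (c * weight Q lab M) (i + card M) * ?r M)"
    unfolding sum_distrib_left mult.assoc[symmetric] scal_mult_scal by (simp add: ac_simps)
  also have "\<dots> = moyal Q (bas P c i) (moyal Q (bas R d j) (bas S e k))"
  proof -
    have "moyal_basis Q R S = (\<Sum>M \<in> matches (pairs lab (E 1) (E 2)).
        bas (glued Q (E 1 \<union> E 2) n lab (trivials R + trivials S) M) (weight Q lab M :: 'k) (card M))"
      unfolding glued_def mterm_bas[symmetric]
    proof (rule moyal_basis_matches[OF iso3(2,3) d3(3)])
      show "finite (E 1 \<union> E 2)" using fin by simp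
      show "bij_betw n (E 1 \<union> E 2) (E 1 \<union> E 2)" by (rule bij_betw_combine[OF n n d3(3)])
      show "walks Q (E 1 \<union> E 2) n lab" using w by (auto simp: walks_def)
    qed
    then show ?thesis by (simp add: moyal_bas moyal_scal_right moyal_sum_right)
  qed
  finally show ?thesis .
qed

theorem mainTheorem3:
  fixes Q :: "('v, 'e) pre_digraph"
    and P R S :: "(('v, 'e) collection \<Rightarrow>\<^sub>0 'k::field_char_0) poly"
  assumes "wf_digraph Q"
    and "P \<in> SymL_h Q" and "R \<in> SymL_h Q" and "S \<in> SymL_h Q"
  shows "moyal Q (moyal Q P R) S = moyal Q P (moyal Q R S)"
  using assms(2)
\<comment> \<open>Both sides are additive in each argument separately, so three nested inductions
  reduce the claim to single collections with coefficients.\<close>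
proof (induction P rule: SymL_h_induct)
  case P: (basis P c i)
  show ?case using assms(3)
  proof (induction R rule: SymL_h_induct)
    case R: (basis R d j)
    show ?case using assms(4)
    proof (induction S rule: SymL_h_induct)
      case (basis S e k)
      then show ?case by (rule moyal_assoc_basis[OF P R])
    qed (simp_all add: moyal_add_right)
  qed (simp_all add: moyal_add_left moyal_add_right)
qed (simp_all add: moyal_add_left)

end
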